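(* Let $\{z^t\}$ be the sequence of SQG-estimates at a point $x\in X$. Assume that (i) for all $t$ the tracked densities $g^t$ belong to $G$ and $|g^{t+1}(x)-g^t(x)|\le\delta_t(x)\to0$; (ii) the kernel $K$ is a bounded Borel density with $\int_X K(y)\,dy=1$, $\sup_{y\in X} K(y)\le\overline K$, and $\int_{\mathbb{R}^r}\|y\|^{\nu}K(y)\,dy<+\infty$; (iii) the adjustment coefficients $\rho_t>0$ and window parameters $\theta_t>0$ satisfy $$\lim_{t\to\infty}\frac{\delta_t(x)}{\rho_t}=0\ \text{ a.s.},\qquad \lim_{t\to\infty}\rho_t=\lim_{t\to\infty}\theta_t=0\ \text{ a.s.},\qquad \sum_{t=0}^{\infty}\rho_t=+\infty\ \text{ a.s.},\qquad \sum_{t=0}^{\infty}\mathbf{E}\frac{\rho_t^2}{\theta_t^r}<+\infty.$$ Then at any point $x$ where all densities $g^t$ are globally Hölder continuous (with constants $H=H(x)$, $\nu=\nu(x)>0$), with probability one $$\lim_{t\to\infty}(z^t-g^t(x))=0.$$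
   Context: Let $X\subseteq\mathbb{R}^r$. $G$ is the class of functions $g$ on $X$ with $0\le\underline g(x)\le g(x)\le\overline g(x)\le\overline g$ for all $x\in X$, where $\underline g(\cdot),\overline g(\cdot)$ are given functions and $\overline g$ is a finite constant. For $t=0,1,\dots$, $g^t$ is a probability density on $X$; the observations $\overline x_0,\overline x_1,\dots$ are independent random vectors on a probability space $(\Omega,\Sigma,P)$, $\overline x_t$ having density $g^t$. $K\ge0$ is a kernel. Global Hölder continuity at $x$: there are $H=H(x)$ and $\nu=\nu(x)>0$, not depending on $t$, such that $|g^t(x)-g^t(y)|\le H\|x-y\|^{\nu}$ for all $y\in X$ and all $t$. SQG-estimates at $x$: given $z^0\in[\underline g(x),\overline g(x)]$ and (possibly random) adjustment coefficients $\rho_t$ and window parameters $\theta_t$, measurable with respect to the $\sigma$-algebra generated by $\overline x_0,\dots,\overline x_{t-1}$, $$z^{t+1}=\min\{\overline g(x),\max\{\underline g(x),\,z^t-\rho_t\xi_t\}\},\qquad \xi_t=z^t-\frac1{\theta_t^r}K\Big(\frac{\overline x_t-x}{\theta_t}\Big),\quad t=0,1,\dots$$ $\mathbf{E}$ denotes expectation.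
   Formalization: Added assumption: the integral over X of θ^{-r}K((y-x)/θ) tends to 1 as θ→0+ (automatic if x is interior to X and K integrates to 1 over R^r); without it the claim fails, e.g. X=[0,1], x=1, K the indicator of [0,1], g^t=1. X is taken to be Borel. *)

theory Defs
  imports "HOL-Probability.Probability"
begin

definition density_class ::
    "'a set \<Rightarrow> ('a \<Rightarrow> real) \<Rightarrow> ('a \<Rightarrow> real) \<Rightarrow> real \<Rightarrow> ('a \<Rightarrow> real) set" where
  "density_class X glow gup gbar =
    {g. \<forall>x\<in>X. 0 \<le> glow x \<and> glow x \<le> g x \<and> g x \<le> gup x \<and> gup x \<le> gbar}"

definition globally_hoelder_at ::
    "'a::real_normed_vector set \<Rightarrow> (nat \<Rightarrow> 'a \<Rightarrow> real) \<Rightarrow> 'a \<Rightarrow> real \<Rightarrow> real \<Rightarrow> bool" where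
  "globally_hoelder_at X g x H \<nu> \<longleftrightarrow>
    \<nu> > 0 \<and> (\<forall>t. \<forall>y\<in>X. \<bar>g t x - g t y\<bar> \<le> H * norm (x - y) powr \<nu>)"

text \<open>The \<open>\<sigma>\<close>-algebra generated by \<open>\<xi> 0, \<dots>, \<xi> (t - 1)\<close>; it is trivial for \<open>t = 0\<close>.\<close>

definition past :: "'w measure \<Rightarrow> (nat \<Rightarrow> 'w \<Rightarrow> 'a::topological_space) \<Rightarrow> nat \<Rightarrow> 'w measure" where
  "past M \<xi> t = sigma (space M) (\<Union>s<t. {\<xi> s -` B \<inter> space M | B. B \<in> sets borel})"

definition scaled_kernel :: "(real^'r \<Rightarrow> real) \<Rightarrow> real^'r \<Rightarrow> real \<Rightarrow> real^'r \<Rightarrow> real" where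
  "scaled_kernel K x \<theta> y = 1 / \<theta> ^ CARD('r) * K ((y - x) /\<^sub>R \<theta>)"

primrec sqg_estimate ::
    "(real^'r \<Rightarrow> real) \<Rightarrow> (real^'r \<Rightarrow> real) \<Rightarrow> (real^'r \<Rightarrow> real) \<Rightarrow> real^'r \<Rightarrow> real
      \<Rightarrow> (nat \<Rightarrow> real) \<Rightarrow> (nat \<Rightarrow> real) \<Rightarrow> (nat \<Rightarrow> real^'r) \<Rightarrow> nat \<Rightarrow> real" where
  "sqg_estimate K glow gup x z0 \<rho> \<theta> obs 0 = z0"
| "sqg_estimate K glow gup x z0 \<rho> \<theta> obs (Suc t) =
    (let z = sqg_estimate K glow gup x z0 \<rho> \<theta> obs t;
         \<xi> = z - scaled_kernel K x (\<theta> t) (obs t)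
     in min (gup x) (max (glow x) (z - \<rho> t * \<xi>)))"

text \<open>
  A kernel normalised by \<open>\<integral>\<^sub>X K = 1\<close> can still lose mass when it is centred at \<open>x\<close> and
  rescaled: with \<open>X = [0,1]\<close>, \<open>x = 1\<close> and \<open>K\<close> the indicator function of \<open>[0,1]\<close>, the rescaled
  kernel vanishes almost everywhere on \<open>X\<close>, and no estimate built from it can track a density at
  \<open>x\<close>. The next predicate says that this does not happen. It follows from \<open>\<integral> K = 1\<close> (over the
  whole space) at every interior point \<open>x\<close> of \<open>X\<close>, so in particular it is automatic if \<open>X\<close> is
  the whole space.
\<close>

definition keeps_mass_at :: "(real^'r) set \<Rightarrow> (real^'r \<Rightarrow> real) \<Rightarrow> real^'r \<Rightarrow> bool" where
  "keeps_mass_at X K x \<longleftrightarrow> ((\<lambda>\<theta>. LBINT y:X. scaled_kernel K x \<theta> y) \<longlongrightarrow> 1) (at_right 0)"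

lemma scaled_kernel_integral:
  fixes K :: "real^'r \<Rightarrow> real"
  assumes [measurable]: "K \<in> borel_measurable borel" "X \<in> sets borel" and \<theta>: "\<theta> > 0"
  shows "(LBINT y:X. scaled_kernel K x \<theta> y) = (LBINT u. indicator X (x + \<theta> *\<^sub>R u) * K u)"
proof -
  have [measurable]: "scaled_kernel K x \<theta> \<in> borel_measurable borel"
    unfolding scaled_kernel_def by measurable
  have "(LBINT y:X. scaled_kernel K x \<theta> y) =
      (\<integral>y. indicator X y * scaled_kernel K x \<theta> y
        \<partial>density (distr lborel borel (\<lambda>u. x + \<theta> *\<^sub>R u)) (\<lambda>_. \<bar>\<theta>\<bar> ^ DIM(real^'r)))"
    using lborel_affine[of \<theta> x] \<theta> by (simp add: set_lebesgue_integral_def)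
  also have "\<dots> = (LBINT u. \<theta> ^ CARD('r) *
      (indicator X (x + \<theta> *\<^sub>R u) * scaled_kernel K x \<theta> (x + \<theta> *\<^sub>R u)))"
    using \<theta> by (subst integral_density) (auto simp: integral_distr simp flip: integral_mult_right_zero)
  also have "\<dots> = (LBINT u. indicator X (x + \<theta> *\<^sub>R u) * K u)"
    using \<theta> by (intro Bochner_Integration.integral_cong) (auto simp: scaled_kernel_def)
  finally show ?thesis .
qed

lemma keeps_mass_at_interior:
  fixes K :: "real^'r \<Rightarrow> real"
  assumes [measurable]: "K \<in> borel_measurable borel" "X \<in> sets borel"
    and K: "(LBINT u. K u) = 1" and x: "x \<in> interior X"
  shows "keeps_mass_at X K x"
proof -
  have int: "integrable lborel K"
    using K not_integrable_integral_eq by force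
  have lim: "((\<lambda>\<theta>. indicator X (x + \<theta> *\<^sub>R u) * K u) \<longlongrightarrow> K u) (at_right 0)" for u
  proof -
    have "((\<lambda>\<theta>::real. x + \<theta> *\<^sub>R u) \<longlongrightarrow> x + 0 *\<^sub>R u) (at_right 0)"
      by (intro tendsto_intros)
    then have "\<forall>\<^sub>F \<theta> in at_right 0. x + \<theta> *\<^sub>R u \<in> interior X"
      using x by (intro topological_tendstoD[where l = x]) auto
    then have "\<forall>\<^sub>F \<theta> in at_right 0. indicator X (x + \<theta> *\<^sub>R u) * K u = K u"
      by eventually_elim (use interior_subset in \<open>auto simp: indicator_def\<close>)
    then show ?thesis
      by (rule tendsto_eventually)
  qed
  have "((\<lambda>\<theta>. LBINT u. indicator X (x + \<theta> *\<^sub>R u) * K u) \<longlongrightarrow> (LBINT u. K u)) (at_right 0)"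
    unfolding tendsto_at_iff_sequentially comp_def
  proof (intro allI impI)
    fix s :: "nat \<Rightarrow> real"
    assume s: "\<forall>i. s i \<in> {0<..} - {0}" "s \<longlonglongrightarrow> 0"
    show "(\<lambda>i. LBINT u. indicator X (x + s i *\<^sub>R u) * K u) \<longlonglongrightarrow> (LBINT u. K u)"
    proof (rule integral_dominated_convergence[where w = "\<lambda>u. norm (K u)"])
      show "AE u in lborel. (\<lambda>i. indicator X (x + s i *\<^sub>R u) * K u) \<longlonglongrightarrow> K u"
        using lim s by (intro AE_I2) (auto simp: tendsto_at_iff_sequentially comp_def)
      show "AE u in lborel. norm (indicator X (x + s i *\<^sub>R u) * K u) \<le> norm (K u)" for i
        by (intro AE_I2) (auto simp: indicator_def)
    qed (use int in auto)
  qed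
  moreover have "\<forall>\<^sub>F \<theta>::real in at_right 0.
      (LBINT u. indicator X (x + \<theta> *\<^sub>R u) * K u) = (LBINT y:X. scaled_kernel K x \<theta> y)"
    using eventually_at_right_less
    by eventually_elim (simp add: scaled_kernel_integral)
  ultimately show ?thesis
    unfolding keeps_mass_at_def K by (rule Lim_transform_eventually)
qed

end

theory Submission
  imports Defs
begin

text \<open>
  Write \<open>w\<^sub>t = z\<^sup>t - g\<^sup>t(x)\<close> and split the kernel observation into \<open>g\<^sup>t(x)\<close>, a bias \<open>\<beta>\<^sub>t\<close> and a
  noise \<open>e\<^sub>t\<close> centred given the past. The bias vanishes as \<open>\<theta>\<^sub>t \<rightarrow> 0\<close> by Hoelder continuity, and
  the conditional variance of \<open>e\<^sub>t\<close> is \<open>O(1 / \<theta>\<^sub>t\<^sup>r)\<close>. Since clamping is nonexpansive, eventually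
  \<open>w\<^sub>t\<^sub>+\<^sub>1\<^sup>2 \<le> (1 - \<rho>\<^sub>t) w\<^sub>t\<^sup>2 + \<rho>\<^sub>t o(1) + 2 \<rho>\<^sub>t (1 - \<rho>\<^sub>t) w\<^sub>t e\<^sub>t + 2 \<rho>\<^sub>t\<^sup>2 e\<^sub>t\<^sup>2\<close>.
  The last two terms are almost surely summable: the first is a martingale difference sequence
  with summable second moments, the second has summable expectations. As \<open>\<Sum>\<rho>\<^sub>t = \<infinity>\<close>, a
  deterministic argument gives \<open>w\<^sub>t \<rightarrow> 0\<close> on almost every path.
\<close>

section \<open>Perturbed recursions\<close>

text \<open>Once \<open>\<eta> t < e/2\<close> and \<open>\<rho> t < 1\<close>, the excess
  \<open>U t - e/2\<close> contracts by the factor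
  \<open>1 - \<rho> t \<le> exp (- \<rho> t)\<close> at each step, so it is dominated by a constant
  times the exponential of minus the partial sums of a divergent series. No sign of \<open>U\<close>
  enters, which allows \<open>U\<close> to be shifted by a null sequence later.\<close>

lemma limsup_recursion_le:
  fixes U \<rho> \<eta> :: "nat \<Rightarrow> real"
  assumes pos: "\<And>t. 0 < \<rho> t" and lim: "\<rho> \<longlonglongrightarrow> 0" and div: "\<not> summable \<rho>"
    and \<eta>: "\<eta> \<longlonglongrightarrow> 0"
    and rec: "\<forall>\<^sub>F t in sequentially. U (Suc t) \<le> (1 - \<rho> t) * U t + \<rho> t * \<eta> t"
    and e: "0 < e"
  shows "\<forall>\<^sub>F t in sequentially. U t < e"
proof -
  have "\<forall>\<^sub>F t in sequentially. U (Suc t) \<le> (1 - \<rho> t) * U t + \<rho> t * \<eta> t \<and> \<rho> t < 1 \<and> \<eta> t < e/2"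
    using rec order_tendstoD(2)[OF lim, of 1] order_tendstoD(2)[OF \<eta>, of "e/2"] e
    by (intro eventually_conj) auto
  then obtain N where N: "\<And>t. t \<ge> N \<Longrightarrow> U (Suc t) \<le> (1 - \<rho> t) * U t + \<rho> t * \<eta> t"
      "\<And>t. t \<ge> N \<Longrightarrow> \<rho> t < 1" "\<And>t. t \<ge> N \<Longrightarrow> \<eta> t < e/2"
    by (auto simp: eventually_sequentially)
  \<comment> \<open>The maximum with 0 covers a negative initial excess; replacing
    \<open>1 - \<rho>\<close> by the larger \<open>exp (- \<rho>)\<close> is monotone only in front
    of a nonnegative constant.\<close>
  define C where "C = max (U N - e/2) 0"
  have step: "U (Suc t) - e/2 \<le> (1 - \<rho> t) * (U t - e/2)" if "t \<ge> N" for t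
  proof -
    have "\<rho> t * \<eta> t \<le> \<rho> t * (e/2)"
      using N(3)[OF that] pos[of t] by (intro mult_left_mono) auto
    moreover have "(1 - \<rho> t) * (U t - e/2) = (1 - \<rho> t) * U t + \<rho> t * (e/2) - e/2"
      by (simp add: left_diff_distrib right_diff_distrib diff_divide_distrib)
    ultimately show ?thesis using N(1)[OF that] by linarith
  qed
  have bound: "U (N + k) - e/2 \<le> exp (- (\<Sum>j<k. \<rho> (N + j))) * C" for k
  proof (induction k)
    case 0
    then show ?case by (simp add: C_def)
  next
    case (Suc k)
    have "U (N + Suc k) - e/2 \<le> (1 - \<rho> (N + k)) * (U (N + k) - e/2)"
      using step[of "N + k"] by simp
    also have "\<dots> \<le> (1 - \<rho> (N + k)) * (exp (- (\<Sum>j<k. \<rho> (N + j))) * C)"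
      using N(2)[of "N + k"] Suc by (intro mult_left_mono) auto
    also have "\<dots> \<le> exp (- \<rho> (N + k)) * (exp (- (\<Sum>j<k. \<rho> (N + j))) * C)"
      using exp_ge_add_one_self[of "- \<rho> (N + k)"] by (intro mult_right_mono) (auto simp: C_def)
    also have "\<dots> = exp (- (\<Sum>j<Suc k. \<rho> (N + j))) * C"
      by (simp add: mult_exp_exp flip: mult.assoc)
    finally show ?case .
  qed
  have "\<not> summable (\<lambda>j. \<rho> (N + j))"
    using div summable_iff_shift[of \<rho> N] by (simp add: add.commute)
  have "filterlim (\<lambda>k. \<Sum>j<k. \<rho> (N + j)) at_top sequentially"
    unfolding filterlim_at_top
  proof
    fix Z
    obtain n where n: "Z < (\<Sum>j<n. \<rho> (N + j))"
      using summableI_nonneg_bounded[of "\<lambda>j. \<rho> (N + j)" Z] pos \<open>\<not> summable (\<lambda>j. \<rho> (N + j))\<close>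
      by (metis less_imp_le not_less)
    have "Z \<le> (\<Sum>j<k. \<rho> (N + j))" if "k \<ge> n" for k
      using n sum_mono2[of "{..<k}" "{..<n}" "\<lambda>j. \<rho> (N + j)"] that pos by (force intro: less_imp_le)
    then show "\<forall>\<^sub>F k in sequentially. Z \<le> (\<Sum>j<k. \<rho> (N + j))"
      unfolding eventually_sequentially by blast
  qed
  then have "(\<lambda>k. exp (- (\<Sum>j<k. \<rho> (N + j))) * C) \<longlonglongrightarrow> 0 * C"
    by (intro tendsto_mult tendsto_const filterlim_compose[OF exp_at_bot])
      (simp add: filterlim_uminus_at_bot)
  then have "\<forall>\<^sub>F k in sequentially. exp (- (\<Sum>j<k. \<rho> (N + j))) * C < e/2"
    using e by (intro order_tendstoD) auto
  then have "\<forall>\<^sub>F k in sequentially. U (k + N) < e"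
  proof eventually_elim
    case (elim k)
    then show ?case using bound[of k] by (simp add: add.commute)
  qed
  then show ?thesis
    by (subst (asm) eventually_sequentially_seg)
qed

text \<open>Adding the tail of the convergent series of \<open>m\<close> to \<open>V\<close> absorbs the perturbation.\<close>

lemma perturbed_recursion_tendsto_0:
  fixes V \<rho> \<eta> m :: "nat \<Rightarrow> real"
  assumes pos: "\<And>t. 0 < \<rho> t" and lim: "\<rho> \<longlonglongrightarrow> 0" and div: "\<not> summable \<rho>"
    and \<eta>: "\<eta> \<longlonglongrightarrow> 0" and m: "summable m" and V: "\<And>t. 0 \<le> V t"
    and rec: "\<forall>\<^sub>F t in sequentially. V (Suc t) \<le> (1 - \<rho> t) * V t + \<rho> t * \<eta> t + m t"
  shows "V \<longlonglongrightarrow> 0"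
proof -
  define R where "R t = (\<Sum>j. m (j + t))" for t
  have R_Suc: "R t = m t + R (Suc t)" for t
    using suminf_split_head[OF summable_ignore_initial_segment[OF m, of t]] by (simp add: R_def)
  have R: "R \<longlonglongrightarrow> 0"
    unfolding R_def by (rule suminf_exist_split2[OF m])
  \<comment> \<open>The perturbation telescopes because \<open>m t = R t - R (Suc t)\<close>. The
    price is the term \<open>\<rho> t * R t\<close>, which joins \<open>\<rho> t * \<eta> t\<close>
    since \<open>R\<close> vanishes. Convergence of the series of \<open>m\<close> may be merely
    conditional, so \<open>R\<close> can change sign.\<close>
  have UR: "\<forall>\<^sub>F t in sequentially. V t + R t < e" if "0 < e" for e
  proof (rule limsup_recursion_le[OF pos lim div _ _ that])
    show "(\<lambda>t. \<eta> t + R t) \<longlonglongrightarrow> 0"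
      using tendsto_add[OF \<eta> R] by simp
    show "\<forall>\<^sub>F t in sequentially.
        V (Suc t) + R (Suc t) \<le> (1 - \<rho> t) * (V t + R t) + \<rho> t * (\<eta> t + R t)"
      using rec
    proof eventually_elim
      case (elim t)
      then show ?case
        using R_Suc[of t] by (simp add: algebra_simps)
    qed
  qed
  show ?thesis
  proof (rule order_tendstoI)
    fix a :: real assume "a < 0"
    then show "\<forall>\<^sub>F t in sequentially. a < V t"
      using V by (intro always_eventually) (meson less_le_trans)
  next
    fix a :: real assume "0 < a"
    then have "\<forall>\<^sub>F t in sequentially. V t + R t < a/2" "\<forall>\<^sub>F t in sequentially. - a/2 < R t"
      using UR[of "a/2"] order_tendstoD(1)[OF R, of "- a/2"] by auto
    then show "\<forall>\<^sub>F t in sequentially. V t < a"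
      by eventually_elim simp
  qed
qed

text \<open>The deterministic core, meant for one sample path: \<open>a\<close> is the target,
  \<open>\<beta>\<close> the bias, \<open>e\<close> the noise. The squared error satisfies a
  perturbed recursion whose perturbation is the cross term plus the squared noise. The factor
  \<open>max 0 (1 - \<rho> t)\<close> is just \<open>1 - \<rho> t\<close> as soon as
  \<open>\<rho> t < 1\<close>, which is eventually the case.\<close>

lemma clamped_tracking_tendsto:
  fixes z a \<rho> \<delta> \<beta> e :: "nat \<Rightarrow> real"
  assumes z0: "z 0 \<in> {l..u}" and a: "\<And>t. a t \<in> {l..u}"
    and step: "\<And>t. z (Suc t) = min u (max l (z t - \<rho> t * (z t - (a t + \<beta> t + e t))))"
    and drift: "\<And>t. \<bar>a (Suc t) - a t\<bar> \<le> \<delta> t" and rate: "(\<lambda>t. \<delta> t / \<rho> t) \<longlonglongrightarrow> 0"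
    and \<beta>: "\<beta> \<longlonglongrightarrow> 0"
    and \<rho>: "\<And>t. 0 < \<rho> t" "\<rho> \<longlonglongrightarrow> 0" "\<not> summable \<rho>"
    and noise: "summable (\<lambda>t. \<rho> t * max 0 (1 - \<rho> t) * (z t - a t) * e t)"
    and noise_sq: "summable (\<lambda>t. (\<rho> t * e t)\<^sup>2)"
  shows "(\<lambda>t. z t - a t) \<longlonglongrightarrow> 0"
proof -
  define w where "w t = z t - a t" for t
  \<comment> \<open>Bias and drift of the target together, measured per unit of step size: their
    joint effect \<open>q\<close> in one step is at most
    \<open>\<rho> t * \<gamma> t\<close>.\<close>
  define \<gamma> where "\<gamma> t = \<bar>\<beta> t\<bar> + \<delta> t / \<rho> t" for t
  define W where "W = u - l"
  have z: "z t \<in> {l..u}" for t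
    by (cases t) (use z0 step in auto)
  have w_le: "\<bar>w t\<bar> \<le> W" for t
    using z[of t] a[of t] by (auto simp: w_def W_def)
  have \<delta>: "0 \<le> \<delta> t" for t
    using drift[of t] abs_ge_zero order_trans by blast
  have \<gamma>0: "0 \<le> \<gamma> t" for t
    using \<delta>[of t] \<rho>(1)[of t] by (simp add: \<gamma>_def)
  have \<gamma>: "\<gamma> \<longlonglongrightarrow> 0"
    unfolding \<gamma>_def using tendsto_add[OF tendsto_rabs_zero[OF \<beta>] rate] by simp
  have rec: "(w (Suc t))\<^sup>2 \<le> (1 - \<rho> t) * (w t)\<^sup>2 + \<rho> t * (2 * W * \<gamma> t + 2 * (\<gamma> t)\<^sup>2) +
      (2 * (\<rho> t * max 0 (1 - \<rho> t) * w t * e t) + 2 * (\<rho> t * e t)\<^sup>2)" if "\<rho> t < 1" for t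
  proof -
    define q where "q = \<rho> t * \<beta> t + (a t - a (Suc t))"
    let ?v = "z t - \<rho> t * (z t - (a t + \<beta> t + e t))"
    have q: "\<bar>q\<bar> \<le> \<rho> t * \<gamma> t"
    proof -
      have "\<bar>q\<bar> \<le> \<bar>\<rho> t * \<beta> t\<bar> + \<bar>a t - a (Suc t)\<bar>"
        unfolding q_def by (rule abs_triangle_ineq)
      also have "\<dots> \<le> \<rho> t * \<bar>\<beta> t\<bar> + \<delta> t"
        using drift[of t] \<rho>(1)[of t] by (simp add: abs_mult abs_minus_commute)
      also have "\<dots> = \<rho> t * \<gamma> t"
        using \<rho>(1)[of t] by (simp add: \<gamma>_def field_simps)
      finally show ?thesis .
    qed
    \<comment> \<open>The new target lies in \<open>{l..u}\<close>, so clamping to that interval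
      cannot increase the distance to it.\<close>
    have "\<bar>w (Suc t)\<bar> \<le> \<bar>?v - a (Suc t)\<bar>"
      using a[of "Suc t"] unfolding w_def step by (auto simp: min_def max_def)
    also have "?v - a (Suc t) = (1 - \<rho> t) * w t + \<rho> t * e t + q"
      by (simp add: w_def q_def algebra_simps)
    finally have "(w (Suc t))\<^sup>2 \<le> ((1 - \<rho> t) * w t + \<rho> t * e t + q)\<^sup>2"
      by (simp add: abs_le_square_iff)
    also have "\<dots> = (1 - \<rho> t)\<^sup>2 * (w t)\<^sup>2 + 2 * (\<rho> t * (1 - \<rho> t) * w t * e t) +
        2 * ((1 - \<rho> t) * w t * q) + (\<rho> t * e t + q)\<^sup>2"
      by (simp add: power2_eq_square algebra_simps)
    \<comment> \<open>The noise cross term is kept exactly, because its summability rests on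
      cancellation. The other terms are estimated using \<open>0 < \<rho> t < 1\<close>,
      \<open>\<bar>w t\<bar> \<le> W\<close>, the bound on \<open>q\<close>, and
      \<open>(p + q)\<^sup>2 \<le> 2 * p\<^sup>2 + 2 * q\<^sup>2\<close>.\<close>
    also have "\<dots> \<le> (1 - \<rho> t) * (w t)\<^sup>2 + 2 * (\<rho> t * (1 - \<rho> t) * w t * e t) +
        2 * (W * (\<rho> t * \<gamma> t)) + (2 * (\<rho> t * e t)\<^sup>2 + 2 * (\<rho> t * (\<gamma> t)\<^sup>2))"
    proof (intro add_mono order_refl)
      show "(1 - \<rho> t)\<^sup>2 * (w t)\<^sup>2 \<le> (1 - \<rho> t) * (w t)\<^sup>2"
        using that \<rho>(1)[of t] by (intro mult_right_mono) (simp_all add: power2_eq_square mult_left_le_one_le)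
      have "\<bar>(1 - \<rho> t) * w t * q\<bar> \<le> 1 * W * (\<rho> t * \<gamma> t)"
        unfolding abs_mult using that \<rho>(1)[of t] w_le[of t] q
        by (intro mult_mono) auto
      then show "2 * ((1 - \<rho> t) * w t * q) \<le> 2 * (W * (\<rho> t * \<gamma> t))"
        by simp
      have "q\<^sup>2 \<le> (\<rho> t * \<gamma> t)\<^sup>2"
        using q by (rule abs_le_square_iff[THEN iffD1, OF order_trans]) simp
      also have "\<dots> \<le> \<rho> t * (\<gamma> t)\<^sup>2"
        using that \<rho>(1)[of t] unfolding power_mult_distrib
        by (intro mult_right_mono) (simp_all add: power2_eq_square mult_left_le_one_le)
      finally have "q\<^sup>2 \<le> \<rho> t * (\<gamma> t)\<^sup>2" .
      moreover have "0 \<le> (\<rho> t * e t - q)\<^sup>2"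
        by simp
      ultimately show "(\<rho> t * e t + q)\<^sup>2 \<le> 2 * (\<rho> t * e t)\<^sup>2 + 2 * (\<rho> t * (\<gamma> t)\<^sup>2)"
        by (simp add: power2_sum power2_diff)
    qed
    finally show ?thesis
      using that by (simp add: algebra_simps)
  qed
  have "(\<lambda>t. (w t)\<^sup>2) \<longlonglongrightarrow> 0"
  proof (rule perturbed_recursion_tendsto_0[OF \<rho>])
    show "(\<lambda>t. 2 * W * \<gamma> t + 2 * (\<gamma> t)\<^sup>2) \<longlonglongrightarrow> 0"
      by (auto intro!: tendsto_eq_intros \<gamma>)
    show "summable (\<lambda>t. 2 * (\<rho> t * max 0 (1 - \<rho> t) * w t * e t) + 2 * (\<rho> t * e t)\<^sup>2)"
      unfolding w_def by (intro summable_add summable_mult noise noise_sq)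
    show "\<forall>\<^sub>F t in sequentially. (w (Suc t))\<^sup>2 \<le> (1 - \<rho> t) * (w t)\<^sup>2 +
        \<rho> t * (2 * W * \<gamma> t + 2 * (\<gamma> t)\<^sup>2) +
        (2 * (\<rho> t * max 0 (1 - \<rho> t) * w t * e t) + 2 * (\<rho> t * e t)\<^sup>2)"
      using order_tendstoD(2)[OF \<rho>(2), of 1] by (auto elim: eventually_mono intro: rec)
  qed simp
  then show ?thesis
    by (simp add: w_def)
qed

section \<open>Square-integrable martingale differences\<close>

text \<open>By monotone convergence the sum has a finite integral, and a nonnegative function with
  finite integral is finite almost everywhere.\<close>

lemma summable_of_nn_integral_suminf:
  fixes f :: "nat \<Rightarrow> 'a \<Rightarrow> real"
  assumes meas: "\<And>n. f n \<in> borel_measurable M" and pos: "\<And>n \<omega>. 0 \<le> f n \<omega>"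
    and fin: "(\<Sum>n. \<integral>\<^sup>+\<omega>. ennreal (f n \<omega>) \<partial>M) < \<infinity>"
  shows "integrable M (f n)" and "summable (\<lambda>n. \<integral>\<omega>. f n \<omega> \<partial>M)"
    and "AE \<omega> in M. summable (\<lambda>n. f n \<omega>)"
proof -
  note [measurable] = meas
  have "(\<integral>\<^sup>+\<omega>. ennreal (f n \<omega>) \<partial>M) < \<infinity>" for n
    using fin sum_le_suminf[of "\<lambda>n. \<integral>\<^sup>+\<omega>. ennreal (f n \<omega>) \<partial>M" "{n}"] by (auto intro: le_less_trans)
  then show int: "integrable M (f n)" for n
    using pos by (intro integrableI_nonneg) auto
  have "(\<Sum>n. ennreal (\<integral>\<omega>. f n \<omega> \<partial>M)) < \<infinity>"
    using fin int pos by (simp add: nn_integral_eq_integral)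
  then show "summable (\<lambda>n. \<integral>\<omega>. f n \<omega> \<partial>M)"
    using pos by (intro summable_suminf_not_top) auto
  have "(\<integral>\<^sup>+\<omega>. (\<Sum>n. ennreal (f n \<omega>)) \<partial>M) \<noteq> \<infinity>"
    using fin by (subst nn_integral_suminf) auto
  then have "AE \<omega> in M. (\<Sum>n. ennreal (f n \<omega>)) \<noteq> \<infinity>"
    by (intro nn_integral_PInf_AE) auto
  then show "AE \<omega> in M. summable (\<lambda>n. f n \<omega>)"
    by eventually_elim (use pos in \<open>auto intro: summable_suminf_not_top\<close>)
qed

text \<open>The index shift fits \<open>past\<close>, which at \<open>t\<close> contains the
  observations before \<open>t\<close> only: an increment built from observation \<open>t\<close> is
  centred given time \<open>t\<close> and known at time \<open>t + 1\<close>.\<close>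

locale square_integrable_mds = prob_space M for M :: "'a measure" +
  fixes F :: "nat \<Rightarrow> 'a measure" and d :: "nat \<Rightarrow> 'a \<Rightarrow> real"
  assumes subalg: "\<And>n. subalgebra M (F n)"
    and filtration: "\<And>n. subalgebra (F (Suc n)) (F n)"
    and adapted: "\<And>n. d n \<in> borel_measurable (F (Suc n))"
    and square_integrable: "\<And>n. integrable M (\<lambda>\<omega>. (d n \<omega>)\<^sup>2)"
    and cond_exp_0: "\<And>n. AE \<omega> in M. real_cond_exp M (F n) (d n) \<omega> = 0"
begin

lemma measurable_d[measurable]: "d n \<in> borel_measurable M"
  using measurable_from_subalg[OF subalg adapted] .

lemma filtration_mono: "m \<le> n \<Longrightarrow> subalgebra (F n) (F m)"
proof (induction n)
  case (Suc n)
  then show ?case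
    using filtration[of n] by (cases "m = Suc n") (auto simp: subalgebra_def)
qed (simp add: subalgebra_def)

lemma adapted_le: "m < n \<Longrightarrow> d m \<in> borel_measurable (F n)"
  using measurable_from_subalg[OF filtration_mono adapted] by (simp add: Suc_le_eq)

lemma sum_adapted: "m \<le> n \<Longrightarrow> (\<lambda>\<omega>. \<Sum>i<m. d i \<omega>) \<in> borel_measurable (F n)"
  using adapted_le by (intro borel_measurable_sum) auto

text \<open>A factor \<open>h\<close> known at time \<open>n\<close> can be pulled out of the
  conditional expectation, which is 0. Integrability of the product follows from \<open>2 *
  \<bar>h\<bar> * \<bar>d\<bar> \<le> h\<^sup>2 + d\<^sup>2\<close>.\<close>

lemma orthogonal:
  assumes h: "h \<in> borel_measurable (F n)" and h2: "integrable M (\<lambda>\<omega>. (h \<omega>)\<^sup>2)"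
  shows "integrable M (\<lambda>\<omega>. h \<omega> * d n \<omega>)" "(\<integral>\<omega>. h \<omega> * d n \<omega> \<partial>M) = 0"
proof -
  interpret finite_measure_subalgebra M "F n"
    by unfold_locales (rule subalg)
  have [measurable]: "h \<in> borel_measurable M"
    using measurable_from_subalg[OF subalg h] .
  show int: "integrable M (\<lambda>\<omega>. h \<omega> * d n \<omega>)"
  proof (rule Bochner_Integration.integrable_bound)
    show "integrable M (\<lambda>\<omega>. (h \<omega>)\<^sup>2 + (d n \<omega>)\<^sup>2)"
      using h2 square_integrable by simp
    show "AE \<omega> in M. norm (h \<omega> * d n \<omega>) \<le> norm ((h \<omega>)\<^sup>2 + (d n \<omega>)\<^sup>2)"
    proof (rule AE_I2)
      fix \<omega>
      have "2 * \<bar>h \<omega>\<bar> * \<bar>d n \<omega>\<bar> \<le> (h \<omega>)\<^sup>2 + (d n \<omega>)\<^sup>2"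
        using sum_squares_bound[of "\<bar>h \<omega>\<bar>" "\<bar>d n \<omega>\<bar>"] by simp
      moreover have "0 \<le> \<bar>h \<omega>\<bar> * \<bar>d n \<omega>\<bar>" by simp
      ultimately have "\<bar>h \<omega>\<bar> * \<bar>d n \<omega>\<bar> \<le> (h \<omega>)\<^sup>2 + (d n \<omega>)\<^sup>2" by linarith
      then show "norm (h \<omega> * d n \<omega>) \<le> norm ((h \<omega>)\<^sup>2 + (d n \<omega>)\<^sup>2)"
        by (simp add: abs_mult)
    qed
  qed measurable
  have "(\<integral>\<omega>. h \<omega> * d n \<omega> \<partial>M) = (\<integral>\<omega>. h \<omega> * real_cond_exp M (F n) (d n) \<omega> \<partial>M)"
    using real_cond_exp_intg(2)[OF int h] by simp
  also have "\<dots> = 0"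
    using cond_exp_0[of n] by (intro integral_eq_zero_AE) auto
  finally show "(\<integral>\<omega>. h \<omega> * d n \<omega> \<partial>M) = 0" .
qed

text \<open>
  Kolmogorov's maximal inequality follows by stopping when the partial sums first reach \<open>\<epsilon>\<close> in
  absolute value: stopping does not increase the second moment, and the stopped sum remains at the
  exceeding value.
\<close>

definition stopped_sum :: "real \<Rightarrow> nat \<Rightarrow> 'a \<Rightarrow> real" where
  "stopped_sum \<epsilon> n \<omega> = (\<Sum>k<n. of_bool (\<forall>j\<le>k. \<bar>\<Sum>i<j. d i \<omega>\<bar> < \<epsilon>) * d k \<omega>)"

text \<open>The two halves need each other in the induction. The strict bound \<open>j < n\<close>
  in the first half makes the equality cover the very step at which \<open>\<epsilon>\<close> is
  reached; this yields the second half there, and afterwards every increment is switched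
  off.\<close>

lemma stopped_sum_eq_or_ge:
  "((\<forall>j<n. \<bar>\<Sum>i<j. d i \<omega>\<bar> < \<epsilon>) \<longrightarrow> stopped_sum \<epsilon> n \<omega> = (\<Sum>i<n. d i \<omega>)) \<and>
   ((\<exists>j\<le>n. \<epsilon> \<le> \<bar>\<Sum>i<j. d i \<omega>\<bar>) \<longrightarrow> \<epsilon> \<le> \<bar>stopped_sum \<epsilon> n \<omega>\<bar>)"
proof (induction n)
  case 0
  then show ?case by (simp add: stopped_sum_def)
next
  case (Suc n)
  show ?case
  proof (cases "\<forall>j\<le>n. \<bar>\<Sum>i<j. d i \<omega>\<bar> < \<epsilon>")
    case True
    then have "stopped_sum \<epsilon> (Suc n) \<omega> = (\<Sum>i<Suc n. d i \<omega>)"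
      using Suc by (simp add: stopped_sum_def)
    then show ?thesis
      using True by (auto simp: le_Suc_eq)
  next
    case False
    then have "stopped_sum \<epsilon> (Suc n) \<omega> = stopped_sum \<epsilon> n \<omega>"
      by (simp add: stopped_sum_def)
    moreover have "\<epsilon> \<le> \<bar>stopped_sum \<epsilon> n \<omega>\<bar>"
      using False Suc by (auto simp: not_less)
    ultimately show ?thesis
      using False less_Suc_eq_le by auto
  qed
qed

text \<open>Each switched increment is orthogonal to the stopped sum so far, so second moments add
  up, and the switch can only shrink them. Measurability is carried through the induction because
  orthogonality requires it.\<close>

lemma stopped_sum_second_moment:
  "stopped_sum \<epsilon> n \<in> borel_measurable (F n) \<and> integrable M (\<lambda>\<omega>. (stopped_sum \<epsilon> n \<omega>)\<^sup>2) \<and>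
   (\<integral>\<omega>. (stopped_sum \<epsilon> n \<omega>)\<^sup>2 \<partial>M) \<le> (\<Sum>k<n. \<integral>\<omega>. (d k \<omega>)\<^sup>2 \<partial>M)"
proof (induction n)
  case 0
  then show ?case by (simp add: stopped_sum_def)
next
  case (Suc n)
  let ?T = "stopped_sum \<epsilon> n"
  let ?b = "\<lambda>\<omega>. of_bool (\<forall>j\<le>n. \<bar>\<Sum>i<j. d i \<omega>\<bar> < \<epsilon>) :: real"
  have eq: "stopped_sum \<epsilon> (Suc n) \<omega> = ?T \<omega> + ?b \<omega> * d n \<omega>" for \<omega>
    by (simp add: stopped_sum_def)
  have T: "?T \<in> borel_measurable (F n)" "integrable M (\<lambda>\<omega>. (?T \<omega>)\<^sup>2)"
    using Suc by auto
  \<comment> \<open>The switch inspects partial sums up to index \<open>n\<close> only, hence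
    \<open>d i\<close> with \<open>i < n\<close>: it is decided before \<open>d n\<close> is
    revealed.\<close>
  have b: "?b \<in> borel_measurable (F n)"
  proof -
    have [measurable]: "\<And>j. j \<in> {..n} \<Longrightarrow> (\<lambda>\<omega>. \<Sum>i<j. d i \<omega>) \<in> borel_measurable (F n)"
      using sum_adapted by auto
    have "(\<lambda>\<omega>. of_bool (\<forall>j\<in>{..n}. \<bar>\<Sum>i<j. d i \<omega>\<bar> < \<epsilon>) :: real) \<in> borel_measurable (F n)"
      by measurable
    then show ?thesis by (simp add: Ball_def)
  qed
  have [measurable]: "?b \<in> borel_measurable M" "?T \<in> borel_measurable M"
    using measurable_from_subalg[OF subalg] b T(1) by blast+
  have int_d: "integrable M (\<lambda>\<omega>. (?b \<omega> * d n \<omega>)\<^sup>2)"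
    by (rule Bochner_Integration.integrable_bound[OF square_integrable[of n]])
      (auto simp: power_mult_distrib)
  have le_d: "(\<integral>\<omega>. (?b \<omega> * d n \<omega>)\<^sup>2 \<partial>M) \<le> (\<integral>\<omega>. (d n \<omega>)\<^sup>2 \<partial>M)"
    by (rule integral_mono[OF int_d square_integrable]) (auto simp: power_mult_distrib)
  have bT: "(\<lambda>\<omega>. ?T \<omega> * ?b \<omega>) \<in> borel_measurable (F n)"
    using b T(1) by measurable
  have bT2: "integrable M (\<lambda>\<omega>. (?T \<omega> * ?b \<omega>)\<^sup>2)"
    by (rule Bochner_Integration.integrable_bound[OF T(2)]) (auto simp: power_mult_distrib)
  note cross = orthogonal[OF bT bT2]
  have sq: "(stopped_sum \<epsilon> (Suc n) \<omega>)\<^sup>2 =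
      (?T \<omega>)\<^sup>2 + 2 * (?T \<omega> * ?b \<omega> * d n \<omega>) + (?b \<omega> * d n \<omega>)\<^sup>2" for \<omega>
    by (simp add: eq power2_sum algebra_simps)
  have "stopped_sum \<epsilon> (Suc n) \<in> borel_measurable (F (Suc n))"
  proof -
    have [measurable]: "?b \<in> borel_measurable (F (Suc n))" "?T \<in> borel_measurable (F (Suc n))"
      using measurable_from_subalg[OF filtration] b T(1) by blast+
    have [measurable]: "d n \<in> borel_measurable (F (Suc n))"
      by (rule adapted)
    have "(\<lambda>\<omega>. ?T \<omega> + ?b \<omega> * d n \<omega>) \<in> borel_measurable (F (Suc n))"
      by (intro borel_measurable_add borel_measurable_times) fact+
    then show ?thesis
      by (simp only: eq[symmetric])
  qed
  moreover have "integrable M (\<lambda>\<omega>. (stopped_sum \<epsilon> (Suc n) \<omega>)\<^sup>2)"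
    unfolding sq by (intro Bochner_Integration.integrable_add integrable_mult_right cross int_d T)
  moreover have "(\<integral>\<omega>. (stopped_sum \<epsilon> (Suc n) \<omega>)\<^sup>2 \<partial>M) =
      (\<integral>\<omega>. (?T \<omega>)\<^sup>2 \<partial>M) + (\<integral>\<omega>. (?b \<omega> * d n \<omega>)\<^sup>2 \<partial>M)"
    unfolding sq using cross int_d T by simp
  ultimately show ?case
    using Suc le_d by simp
qed

text \<open>Chebyshev's inequality for the stopped sum bounds the event up to each horizon
  \<open>n\<close> by the same number; continuity from below along the increasing events
  \<open>B n\<close> removes the horizon.\<close>

lemma maximal_inequality:
  assumes s: "summable (\<lambda>n. \<integral>\<omega>. (d n \<omega>)\<^sup>2 \<partial>M)" and \<epsilon>: "0 < \<epsilon>"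
  shows "prob {\<omega>\<in>space M. \<exists>k. \<epsilon> \<le> \<bar>\<Sum>i<k. d i \<omega>\<bar>} \<le> (\<Sum>n. \<integral>\<omega>. (d n \<omega>)\<^sup>2 \<partial>M) / \<epsilon>\<^sup>2"
proof -
  define B where "B n = {\<omega>\<in>space M. \<exists>k\<in>{..n}. \<epsilon> \<le> \<bar>\<Sum>i<k. d i \<omega>\<bar>}" for n
  have [measurable]: "B n \<in> sets M" for n
    unfolding B_def by measurable
  have "prob (B n) \<le> (\<Sum>n. \<integral>\<omega>. (d n \<omega>)\<^sup>2 \<partial>M) / \<epsilon>\<^sup>2" for n
  proof -
    note T = stopped_sum_second_moment[of \<epsilon> n]
    have [measurable]: "stopped_sum \<epsilon> n \<in> borel_measurable M"
      using measurable_from_subalg[OF subalg] T by blast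
    have "prob (B n) \<le> prob {\<omega>\<in>space M. \<epsilon> \<le> \<bar>stopped_sum \<epsilon> n \<omega>\<bar>}"
      using stopped_sum_eq_or_ge[of n _ \<epsilon>] by (intro finite_measure_mono) (auto simp: B_def)
    also have "\<dots> \<le> (\<integral>\<omega>. (stopped_sum \<epsilon> n \<omega>)\<^sup>2 \<partial>M) / \<epsilon>\<^sup>2"
      using T \<epsilon> by (intro second_moment_method) auto
    also have "\<dots> \<le> (\<Sum>k<n. \<integral>\<omega>. (d k \<omega>)\<^sup>2 \<partial>M) / \<epsilon>\<^sup>2"
      using T by (intro divide_right_mono) auto
    also have "\<dots> \<le> (\<Sum>n. \<integral>\<omega>. (d n \<omega>)\<^sup>2 \<partial>M) / \<epsilon>\<^sup>2"
      using s by (intro divide_right_mono sum_le_suminf) auto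
    finally show ?thesis .
  qed
  moreover have "(\<lambda>n. prob (B n)) \<longlonglongrightarrow> prob (\<Union>n. B n)"
    by (rule finite_Lim_measure_incseq) (auto simp: B_def incseq_def intro: order_trans)
  ultimately have "prob (\<Union>n. B n) \<le> (\<Sum>n. \<integral>\<omega>. (d n \<omega>)\<^sup>2 \<partial>M) / \<epsilon>\<^sup>2"
    by (intro LIMSEQ_le_const2) auto
  moreover have "(\<Union>n. B n) = {\<omega>\<in>space M. \<exists>k. \<epsilon> \<le> \<bar>\<Sum>i<k. d i \<omega>\<bar>}"
    by (auto simp: B_def)
  ultimately show ?thesis by simp
qed

lemma shift: "square_integrable_mds M (\<lambda>n. F (n + m)) (\<lambda>n. d (n + m))"
  by unfold_locales (use subalg filtration adapted square_integrable cond_exp_0 in auto)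

text \<open>The maximal inequality for the differences from \<open>m\<close> on bounds the
  probability that some sum starting at \<open>m\<close> reaches \<open>\<epsilon>\<close> by
  \<open>a m / \<epsilon>\<^sup>2\<close>, which vanishes as \<open>m\<close> grows. So for each
  \<open>\<epsilon>\<close> almost every path has a starting point beyond which all sums stay below
  \<open>\<epsilon>\<close>, and the levels \<open>1 / Suc j\<close> give the Cauchy
  criterion.\<close>

theorem AE_summable:
  assumes s: "summable (\<lambda>n. \<integral>\<omega>. (d n \<omega>)\<^sup>2 \<partial>M)"
  shows "AE \<omega> in M. summable (\<lambda>n. d n \<omega>)"
proof -
  define a where "a m = (\<Sum>n. \<integral>\<omega>. (d (n + m) \<omega>)\<^sup>2 \<partial>M)" for m
  have a: "a \<longlonglongrightarrow> 0"
    unfolding a_def by (rule suminf_exist_split2[OF s])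
  define A where "A \<epsilon> m = {\<omega>\<in>space M. \<exists>k. \<epsilon> \<le> \<bar>\<Sum>i<k. d (i + m) \<omega>\<bar>}" for \<epsilon> m
  have [measurable]: "A \<epsilon> m \<in> sets M" for \<epsilon> m
    unfolding A_def by measurable
  have bound: "prob (A \<epsilon> m) \<le> a m / \<epsilon>\<^sup>2" if "0 < \<epsilon>" for \<epsilon> m
    unfolding A_def a_def
    using square_integrable_mds.maximal_inequality[OF shift _ that] s
    by (simp add: summable_iff_shift[of "\<lambda>n. \<integral>\<omega>. (d n \<omega>)\<^sup>2 \<partial>M"])
  have "AE \<omega> in M. \<exists>m. \<omega> \<notin> A \<epsilon> m" if "0 < \<epsilon>" for \<epsilon>
  proof -
    have "prob (\<Inter>m. A \<epsilon> m) \<le> a m / \<epsilon>\<^sup>2" for m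
      using bound[OF that, of m] by (rule order_trans[rotated]) (auto intro: finite_measure_mono)
    moreover have "(\<lambda>m. a m / \<epsilon>\<^sup>2) \<longlonglongrightarrow> 0 / \<epsilon>\<^sup>2"
      by (intro tendsto_divide a tendsto_const) (use that in auto)
    ultimately have "prob (\<Inter>m. A \<epsilon> m) \<le> 0"
      by (intro LIMSEQ_le_const[of _ 0]) auto
    then have "prob (\<Inter>m. A \<epsilon> m) = 0"
      by (simp add: measure_le_0_iff)
    then have "(\<Inter>m. A \<epsilon> m) \<in> null_sets M"
      by (intro null_setsI) (auto simp: emeasure_eq_measure)
    then show ?thesis
      by (rule AE_mp[OF AE_not_in]) auto
  qed
  then have "AE \<omega> in M. \<forall>j::nat. \<exists>m. \<omega> \<notin> A (1 / Suc j) m"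
    by (subst AE_all_countable) auto
  with AE_space show ?thesis
  proof eventually_elim
    case (elim \<omega>)
    show ?case
      unfolding summable_Cauchy
    proof (intro allI impI)
      fix e :: real assume "0 < e"
      then obtain j :: nat where j: "1 / Suc j < e/2"
        using nat_approx_posE[of "e/2"] by auto
      obtain m where m: "\<omega> \<notin> A (1 / Suc j) m" using elim by blast
      have small: "\<bar>\<Sum>i<k. d (i + m) \<omega>\<bar> < e/2" for k
      proof -
        have "\<bar>\<Sum>i<k. d (i + m) \<omega>\<bar> < 1 / Suc j"
          using m elim(1) unfolding A_def by (auto simp: not_le)
        then show ?thesis using j by linarith
      qed
      have "norm (sum (\<lambda>n. d n \<omega>) {k..<n}) < e" if "k \<ge> m" for k n
      proof (cases "k \<le> n")
        case True
        have sh: "(\<Sum>i<p - m. d (i + m) \<omega>) = (\<Sum>i=m..<p. d i \<omega>)" if "m \<le> p" for p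
          using sum.shift_bounds_nat_ivl[of "\<lambda>n. d n \<omega>" 0 m "p - m"] that
          by (simp add: atLeast0LessThan)
        \<comment> \<open>A block is the difference of two sums starting at \<open>m\<close>, each
          smaller than \<open>e/2\<close>.\<close>
        have "sum (\<lambda>n. d n \<omega>) {k..<n} =
            (\<Sum>i<n - m. d (i + m) \<omega>) - (\<Sum>i<k - m. d (i + m) \<omega>)"
          using sum.atLeastLessThan_concat[of m k n "\<lambda>n. d n \<omega>"] True that by (simp add: sh)
        then show ?thesis
          using small[of "n - m"] small[of "k - m"] unfolding real_norm_def by linarith
      qed (use \<open>0 < e\<close> in simp)
      then show "\<exists>N. \<forall>m\<ge>N. \<forall>n. norm (sum (\<lambda>n. d n \<omega>) {m..<n}) < e" by blast
    qed
  qed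
qed

end

section \<open>Conditioning on an independent sub-\<open>\<sigma>\<close>-algebra\<close>

context prob_space
begin

context
  fixes F :: "'a measure" and N :: "'b measure" and Y :: "'a \<Rightarrow> 'b"
  assumes subalg: "subalgebra M F" and Y: "random_variable N Y"
    and indep: "indep_set (sets F) {Y -` B \<inter> space M | B. B \<in> sets N}"
begin

lemma measurable_pair_subalgebra: "(\<lambda>\<omega>. (\<omega>, Y \<omega>)) \<in> measurable M (F \<Otimes>\<^sub>M N)"
  using Y measurable_from_subalg[OF subalg measurable_ident] by (simp add: id_def)

text \<open>\<open>F\<close> enters through the identity map, so independence of \<open>F\<close>
  and \<open>Y\<close> becomes a product law, checked on rectangles. Fubini then integrates the
  fresh variable \<open>Y\<close> first while everything determined by \<open>F\<close> is
  frozen.\<close>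

lemma distr_pair_indep_subalgebra:
  "distr M (F \<Otimes>\<^sub>M N) (\<lambda>\<omega>. (\<omega>, Y \<omega>)) = restr_to_subalg M F \<Otimes>\<^sub>M distr M N Y"
proof (rule pair_measure_eqI[symmetric])
  interpret MF: prob_space "restr_to_subalg M F"
    by (rule prob_space_restr_to_subalg[OF subalg prob_space_axioms])
  show "sigma_finite_measure (restr_to_subalg M F)" ..
  interpret Y: prob_space "distr M N Y"
    using Y by (rule prob_space_distr)
  show "sigma_finite_measure (distr M N Y)" ..
  show "sets (restr_to_subalg M F \<Otimes>\<^sub>M distr M N Y) = sets (distr M (F \<Otimes>\<^sub>M N) (\<lambda>\<omega>. (\<omega>, Y \<omega>)))"
    using sets_pair_measure_cong[OF sets_restr_to_subalg[OF subalg] sets_distr] by simp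
  fix A B assume "A \<in> sets (restr_to_subalg M F)" "B \<in> sets (distr M N Y)"
  then have A: "A \<in> sets F" and B: "B \<in> sets N"
    by (simp_all add: sets_restr_to_subalg[OF subalg])
  then have AM: "A \<in> sets M"
    using subalg by (auto simp: subalgebra_def)
  have "prob (A \<inter> (Y -` B \<inter> space M)) = prob A * prob (Y -` B \<inter> space M)"
    using A B by (intro indep_setD[OF indep]) auto
  moreover have "(\<lambda>\<omega>. (\<omega>, Y \<omega>)) -` (A \<times> B) \<inter> space M = A \<inter> (Y -` B \<inter> space M)"
    by auto
  ultimately show "emeasure (restr_to_subalg M F) A * emeasure (distr M N Y) B =
      emeasure (distr M (F \<Otimes>\<^sub>M N) (\<lambda>\<omega>. (\<omega>, Y \<omega>))) (A \<times> B)"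
    using A B AM
    by (simp add: emeasure_restr_to_subalg[OF subalg] emeasure_distr[OF Y]
        emeasure_distr[OF measurable_pair_subalgebra] emeasure_eq_measure ennreal_mult)
qed

lemma nn_integral_indep_subalgebra:
  assumes f: "f \<in> borel_measurable (F \<Otimes>\<^sub>M N)"
  shows "(\<integral>\<^sup>+\<omega>. f (\<omega>, Y \<omega>) \<partial>M) = (\<integral>\<^sup>+\<omega>. \<integral>\<^sup>+y. f (\<omega>, y) \<partial>distr M N Y \<partial>M)"
proof -
  interpret Y: prob_space "distr M N Y"
    using Y by (rule prob_space_distr)
  have f': "f \<in> borel_measurable (restr_to_subalg M F \<Otimes>\<^sub>M distr M N Y)"
    using f by (simp add: measurable_cong_sets[OF sets_pair_measure_cong[OF
        sets_restr_to_subalg[OF subalg] sets_distr] refl])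
  have "(\<lambda>\<omega>. \<integral>\<^sup>+y. f (\<omega>, y) \<partial>distr M N Y) \<in> borel_measurable (restr_to_subalg M F)"
    using f' by (rule Y.borel_measurable_nn_integral_fst)
  then have in_F: "(\<lambda>\<omega>. \<integral>\<^sup>+y. f (\<omega>, y) \<partial>distr M N Y) \<in> borel_measurable F"
    by (simp add: measurable_cong_sets[OF sets_restr_to_subalg[OF subalg] refl])
  have "(\<integral>\<^sup>+\<omega>. f (\<omega>, Y \<omega>) \<partial>M) = (\<integral>\<^sup>+p. f p \<partial>distr M (F \<Otimes>\<^sub>M N) (\<lambda>\<omega>. (\<omega>, Y \<omega>)))"
    using measurable_pair_subalgebra f by (simp add: nn_integral_distr)
  also have "\<dots> = (\<integral>\<^sup>+\<omega>. \<integral>\<^sup>+y. f (\<omega>, y) \<partial>distr M N Y \<partial>restr_to_subalg M F)"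
    using f' by (simp add: distr_pair_indep_subalgebra Y.nn_integral_fst)
  also have "\<dots> = (\<integral>\<^sup>+\<omega>. \<integral>\<^sup>+y. f (\<omega>, y) \<partial>distr M N Y \<partial>M)"
    by (rule nn_integral_subalgebra2[OF subalg in_F])
  finally show ?thesis .
qed

lemma integral_indep_subalgebra:
  fixes f :: "'a \<times> 'b \<Rightarrow> real"
  assumes f: "f \<in> borel_measurable (F \<Otimes>\<^sub>M N)" and int: "integrable M (\<lambda>\<omega>. f (\<omega>, Y \<omega>))"
  shows "(\<lambda>\<omega>. \<integral>y. f (\<omega>, y) \<partial>distr M N Y) \<in> borel_measurable F"
    and "integrable M (\<lambda>\<omega>. \<integral>y. f (\<omega>, y) \<partial>distr M N Y)"
    and "(\<integral>\<omega>. f (\<omega>, Y \<omega>) \<partial>M) = (\<integral>\<omega>. \<integral>y. f (\<omega>, y) \<partial>distr M N Y \<partial>M)"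
proof -
  let ?MF = "restr_to_subalg M F" and ?h = "\<lambda>\<omega>. \<integral>y. f (\<omega>, y) \<partial>distr M N Y"
  interpret MF: prob_space ?MF
    by (rule prob_space_restr_to_subalg[OF subalg prob_space_axioms])
  interpret Y: prob_space "distr M N Y"
    using Y by (rule prob_space_distr)
  interpret P: pair_sigma_finite ?MF "distr M N Y" ..
  have int': "integrable (?MF \<Otimes>\<^sub>M distr M N Y) f"
    using int f measurable_pair_subalgebra by (simp add: distr_pair_indep_subalgebra[symmetric] integrable_distr_eq)
  then have h: "integrable ?MF ?h"
    by (rule P.integrable_fst')
  then show F: "?h \<in> borel_measurable F"
    using measurable_cong_sets[OF sets_restr_to_subalg[OF subalg] refl] by blast
  show "integrable M ?h"
    by (rule integrable_from_subalg[OF subalg h])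
  have "(\<integral>\<omega>. f (\<omega>, Y \<omega>) \<partial>M) = integral\<^sup>L (?MF \<Otimes>\<^sub>M distr M N Y) f"
    using f measurable_pair_subalgebra by (simp add: distr_pair_indep_subalgebra[symmetric] integral_distr)
  also have "\<dots> = integral\<^sup>L ?MF ?h"
    by (rule P.integral_fst'[OF int', symmetric])
  also have "\<dots> = integral\<^sup>L M ?h"
    by (rule integral_subalgebra2[OF subalg F])
  finally show "(\<integral>\<omega>. f (\<omega>, Y \<omega>) \<partial>M) = integral\<^sup>L M ?h" .
qed

text \<open>The freezing lemma. Testing against \<open>A\<close> in \<open>F\<close> amounts to
  absorbing the indicator of \<open>A\<close> into \<open>f\<close>, after which the Fubini identity
  applies.\<close>

lemma real_cond_exp_indep_subalgebra:
  fixes f :: "'a \<times> 'b \<Rightarrow> real"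
  assumes f: "f \<in> borel_measurable (F \<Otimes>\<^sub>M N)" and int: "integrable M (\<lambda>\<omega>. f (\<omega>, Y \<omega>))"
  shows "AE \<omega> in M. real_cond_exp M F (\<lambda>\<omega>. f (\<omega>, Y \<omega>)) \<omega> = (\<integral>y. f (\<omega>, y) \<partial>distr M N Y)"
proof -
  interpret F: finite_measure_subalgebra M F
    by unfold_locales (rule subalg)
  show ?thesis
  proof (rule F.real_cond_exp_charact)
    fix A assume A[measurable]: "A \<in> sets F"
    then have "A \<in> sets M"
      using subalg by (auto simp: subalgebra_def)
    let ?f = "\<lambda>p. indicator A (fst p) * f p"
    have "?f \<in> borel_measurable (F \<Otimes>\<^sub>M N)"
      using f by measurable
    moreover have "integrable M (\<lambda>\<omega>. ?f (\<omega>, Y \<omega>))"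
      using integrable_mult_indicator[OF \<open>A \<in> sets M\<close> int] by simp
    ultimately have "(\<integral>\<omega>. ?f (\<omega>, Y \<omega>) \<partial>M) = (\<integral>\<omega>. \<integral>y. ?f (\<omega>, y) \<partial>distr M N Y \<partial>M)"
      by (rule integral_indep_subalgebra(3))
    then show "(\<integral>\<omega>\<in>A. f (\<omega>, Y \<omega>) \<partial>M) = (\<integral>\<omega>\<in>A. (\<integral>y. f (\<omega>, y) \<partial>distr M N Y) \<partial>M)"
      by (simp add: set_lebesgue_integral_def)
  qed (use integral_indep_subalgebra[OF f int] int in auto)
qed

lemma borel_measurable_integral_section:
  fixes s :: "'a \<times> 'b \<Rightarrow> real"
  assumes s: "s \<in> borel_measurable (F \<Otimes>\<^sub>M N)"
  shows "(\<lambda>\<omega>. \<integral>y. s (\<omega>, y) \<partial>distr M N Y) \<in> borel_measurable F"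
proof -
  interpret Y: prob_space "distr M N Y"
    using Y by (rule prob_space_distr)
  show ?thesis
  proof (rule Y.borel_measurable_lebesgue_integral)
    show "case_prod (\<lambda>\<omega> y. s (\<omega>, y)) \<in> borel_measurable (F \<Otimes>\<^sub>M distr M N Y)"
      using s by (simp add: measurable_cong_sets[OF sets_pair_measure_cong[OF refl sets_distr] refl])
  qed
qed

text \<open>With \<open>\<omega>\<close> frozen, the weight is constant and the centred square
  integrates to a variance, which is at most the raw second moment. With nonnegative integrals,
  integrability of the square can be a consequence of the bound rather than a premise.\<close>

lemma centered_second_moment_le:
  fixes s :: "'a \<times> 'b \<Rightarrow> real"
  assumes s: "s \<in> borel_measurable (F \<Otimes>\<^sub>M N)" and c: "c \<in> borel_measurable F"
    and s2: "\<And>\<omega>. \<omega> \<in> space M \<Longrightarrow> integrable (distr M N Y) (\<lambda>y. (s (\<omega>, y))\<^sup>2)"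
    and v: "\<And>\<omega>. \<omega> \<in> space M \<Longrightarrow> (\<integral>y. (s (\<omega>, y))\<^sup>2 \<partial>distr M N Y) \<le> v \<omega>"
  shows "(\<integral>\<^sup>+\<omega>. ennreal ((c \<omega> * (s (\<omega>, Y \<omega>) - (\<integral>y. s (\<omega>, y) \<partial>distr M N Y)))\<^sup>2) \<partial>M)
    \<le> (\<integral>\<^sup>+\<omega>. ennreal ((c \<omega>)\<^sup>2 * v \<omega>) \<partial>M)"
proof -
  interpret Y: prob_space "distr M N Y"
    using Y by (rule prob_space_distr)
  let ?m = "\<lambda>\<omega>. \<integral>y. s (\<omega>, y) \<partial>distr M N Y"
  have s_section: "(\<lambda>y. s (\<omega>, y)) \<in> borel_measurable N" if "\<omega> \<in> space M" for \<omega>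
    using s subalg that by (intro measurable_compose[OF measurable_Pair1']) (auto simp: subalgebra_def)
  note m = borel_measurable_integral_section[OF s]
  have meas: "(\<lambda>p. ennreal ((c (fst p) * (s p - ?m (fst p)))\<^sup>2)) \<in> borel_measurable (F \<Otimes>\<^sub>M N)"
    using s measurable_compose[OF measurable_fst c] measurable_compose[OF measurable_fst m]
    by measurable
  have "(\<integral>\<^sup>+\<omega>. ennreal ((c \<omega> * (s (\<omega>, Y \<omega>) - ?m \<omega>))\<^sup>2) \<partial>M) =
      (\<integral>\<^sup>+\<omega>. \<integral>\<^sup>+y. ennreal ((c \<omega> * (s (\<omega>, y) - ?m \<omega>))\<^sup>2) \<partial>distr M N Y \<partial>M)"
    using nn_integral_indep_subalgebra[OF meas] by simp
  also have "\<dots> \<le> (\<integral>\<^sup>+\<omega>. ennreal ((c \<omega>)\<^sup>2 * v \<omega>) \<partial>M)"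
  proof (rule nn_integral_mono)
    fix \<omega> assume \<omega>: "\<omega> \<in> space M"
    have [measurable]: "(\<lambda>y. s (\<omega>, y)) \<in> borel_measurable (distr M N Y)"
      using s_section[OF \<omega>] by simp
    have s1: "integrable (distr M N Y) (\<lambda>y. s (\<omega>, y))"
      using s2[OF \<omega>] by (rule Y.square_integrable_imp_integrable[rotated]) simp
    have "integrable (distr M N Y) (\<lambda>y. (s (\<omega>, y) - ?m \<omega>)\<^sup>2)"
      using s1 s2[OF \<omega>] by (simp add: power2_diff)
    then have "(\<integral>\<^sup>+y. ennreal ((c \<omega> * (s (\<omega>, y) - ?m \<omega>))\<^sup>2) \<partial>distr M N Y) =
        ennreal ((c \<omega>)\<^sup>2 * Y.variance (\<lambda>y. s (\<omega>, y)))"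
      by (subst nn_integral_eq_integral) (simp_all add: power_mult_distrib)
    also have "\<dots> \<le> ennreal ((c \<omega>)\<^sup>2 * v \<omega>)"
      using v[OF \<omega>] Y.variance_eq[OF s1 s2[OF \<omega>]]
      by (intro ennreal_leI mult_left_mono) (auto intro: order_trans[rotated])
    finally show "(\<integral>\<^sup>+y. ennreal ((c \<omega> * (s (\<omega>, y) - ?m \<omega>))\<^sup>2) \<partial>distr M N Y)
        \<le> ennreal ((c \<omega>)\<^sup>2 * v \<omega>)" .
  qed
  finally show ?thesis .
qed

text \<open>With \<open>\<omega>\<close> frozen, subtracting the mean makes the inner integral
  vanish, the law of \<open>Y\<close> having total mass 1.\<close>

lemma centered_cond_exp_0:
  fixes s :: "'a \<times> 'b \<Rightarrow> real"
  assumes s: "s \<in> borel_measurable (F \<Otimes>\<^sub>M N)" and c: "c \<in> borel_measurable F"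
    and s1: "\<And>\<omega>. \<omega> \<in> space M \<Longrightarrow> integrable (distr M N Y) (\<lambda>y. s (\<omega>, y))"
    and int: "integrable M (\<lambda>\<omega>. c \<omega> * (s (\<omega>, Y \<omega>) - (\<integral>y. s (\<omega>, y) \<partial>distr M N Y)))"
  shows "AE \<omega> in M. real_cond_exp M F
    (\<lambda>\<omega>. c \<omega> * (s (\<omega>, Y \<omega>) - (\<integral>y. s (\<omega>, y) \<partial>distr M N Y))) \<omega> = 0"
proof -
  interpret Y: prob_space "distr M N Y"
    using Y by (rule prob_space_distr)
  let ?m = "\<lambda>\<omega>. \<integral>y. s (\<omega>, y) \<partial>distr M N Y"
  note m = borel_measurable_integral_section[OF s]
  have "(\<lambda>p. c (fst p) * (s p - ?m (fst p))) \<in> borel_measurable (F \<Otimes>\<^sub>M N)"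
    using s measurable_compose[OF measurable_fst c] measurable_compose[OF measurable_fst m]
    by measurable
  from real_cond_exp_indep_subalgebra[OF this] int
  have "AE \<omega> in M. real_cond_exp M F (\<lambda>\<omega>. c \<omega> * (s (\<omega>, Y \<omega>) - ?m \<omega>)) \<omega> =
      (\<integral>y. c \<omega> * (s (\<omega>, y) - ?m \<omega>) \<partial>distr M N Y)"
    by simp
  with AE_space show ?thesis
  proof eventually_elim
    case (elim \<omega>)
    then show ?case
      using s1[of \<omega>] by (simp add: Y.prob_space[simplified])
  qed
qed

end

end

section \<open>The filtration generated by the observations\<close>

lemma sets_past: "sets (past M \<xi> t) = sigma_sets (space M) (\<Union>s<t. {\<xi> s -` B \<inter> space M | B. B \<in> sets borel})"
  unfolding past_def by (rule sets_measure_of) auto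

lemma space_past: "space (past M \<xi> t) = space M"
  unfolding past_def by (rule space_measure_of) auto

lemma subalgebra_past:
  assumes "\<And>t. \<xi> t \<in> borel_measurable M"
  shows "subalgebra M (past M \<xi> t)"
  unfolding subalgebra_def sets_past space_past
  using assms by (auto intro!: sets.sigma_sets_subset measurable_sets)

lemma past_mono: "s \<le> t \<Longrightarrow> subalgebra (past M \<xi> t) (past M \<xi> s)"
  unfolding subalgebra_def sets_past space_past
  by (intro conjI refl sigma_sets_mono') (auto dest: less_le_trans)

lemma measurable_past: "s < t \<Longrightarrow> \<xi> s \<in> borel_measurable (past M \<xi> t)"
  by (rule measurableI) (auto simp: space_past sets_past intro: sigma_sets.Basic)

text \<open>Disjoint index blocks of an independent family, here \<open>{..<t}\<close> and
  \<open>{t}\<close>, generate independent \<open>\<sigma>\<close>-algebras. The second one is then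
  shrunk to the preimages, the form used for conditioning.\<close>

lemma (in prob_space) indep_set_past:
  fixes \<xi> :: "nat \<Rightarrow> 'a \<Rightarrow> 'b::topological_space"
  assumes indep: "indep_vars (\<lambda>_. borel) \<xi> UNIV"
  shows "indep_set (sets (past M \<xi> t)) {\<xi> t -` B \<inter> space M | B. B \<in> sets borel}"
proof -
  let ?E = "\<lambda>s. {\<xi> s -` B \<inter> space M | B. B \<in> sets borel}"
  let ?I = "case_bool {..<t} {t}"
  have "indep_sets (\<lambda>b. sigma_sets (space M) (\<Union>s\<in>?I b. ?E s)) UNIV"
  proof (rule indep_sets_collect_sigma)
    show "indep_sets ?E (\<Union>b. ?I b)"
      using indep unfolding indep_vars_def2 by (blast intro: indep_sets_mono_index)
    show "Int_stable (?E s)" for s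
    proof (rule Int_stableI)
      fix a b assume "a \<in> ?E s" "b \<in> ?E s"
      then obtain A B where "a = \<xi> s -` A \<inter> space M" "b = \<xi> s -` B \<inter> space M"
          "A \<in> sets borel" "B \<in> sets borel"
        by auto
      then show "a \<inter> b \<in> ?E s"
        by (intro CollectI exI[of _ "A \<inter> B"]) auto
    qed
    show "disjoint_family_on ?I UNIV"
      by (auto simp: disjoint_family_on_def split: bool.splits)
  qed
  moreover have "(\<lambda>b. sigma_sets (space M) (\<Union>s\<in>?I b. ?E s)) =
      case_bool (sets (past M \<xi> t)) (sigma_sets (space M) (?E t))"
    by (auto simp: sets_past fun_eq_iff split: bool.split)
  ultimately have "indep_set (sets (past M \<xi> t)) (sigma_sets (space M) (?E t))"
    by (simp add: indep_set_def)
  then show ?thesis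
    unfolding indep_set_def
    by (rule indep_sets_mono_sets) (auto split: bool.split intro: sigma_sets.Basic)
qed

section \<open>Rescaled kernels\<close>

lemma integrable_lborel_affine:
  fixes f :: "real^'r \<Rightarrow> real"
  assumes [measurable]: "f \<in> borel_measurable borel" and \<theta>: "0 < \<theta>"
    and int: "integrable lborel (\<lambda>u. f (x + \<theta> *\<^sub>R u))"
  shows "integrable lborel f"
proof -
  have "integrable (density (distr lborel borel (\<lambda>u. x + \<theta> *\<^sub>R u)) (\<lambda>_. \<bar>\<theta>\<bar> ^ DIM(real^'r))) f"
    using int \<theta> by (subst integrable_density) (auto simp: integrable_distr_eq)
  then show ?thesis
    using lborel_affine[of \<theta> x] \<theta> by simp
qed

lemma measurable_scaled_kernel[measurable]:
  fixes K :: "real^'r \<Rightarrow> real"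
  assumes [measurable]: "K \<in> borel_measurable borel" "f \<in> borel_measurable N" "h \<in> borel_measurable N"
  shows "(\<lambda>p. scaled_kernel K x (f p) (h p)) \<in> borel_measurable N"
  unfolding scaled_kernel_def by measurable

lemma integrable_scaled_kernel:
  fixes K :: "real^'r \<Rightarrow> real"
  assumes [measurable]: "K \<in> borel_measurable borel" and int: "integrable lborel K" and \<theta>: "0 < \<theta>"
  shows "integrable lborel (scaled_kernel K x \<theta>)"
proof (rule integrable_lborel_affine[OF _ \<theta>, of _ x])
  show "scaled_kernel K x \<theta> \<in> borel_measurable borel"
    by measurable
  show "integrable lborel (\<lambda>u. scaled_kernel K x \<theta> (x + \<theta> *\<^sub>R u))"
    using int \<theta> by (simp add: scaled_kernel_def)
qed

lemma integral_scaled_kernel: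
  fixes K :: "real^'r \<Rightarrow> real"
  assumes "K \<in> borel_measurable borel" "0 < \<theta>"
  shows "(LBINT y. scaled_kernel K x \<theta> y) = (LBINT u. K u)"
  using scaled_kernel_integral[OF assms(1) _ assms(2), of UNIV x]
  by (simp add: set_lebesgue_integral_def)

lemma scaled_kernel_nonneg:
  fixes K :: "real^'r \<Rightarrow> real"
  shows "(\<And>u. 0 \<le> K u) \<Longrightarrow> 0 < \<theta> \<Longrightarrow> 0 \<le> scaled_kernel K x \<theta> y"
  by (simp add: scaled_kernel_def)

text \<open>Homogeneity of the norm extracts \<open>\<theta> powr \<nu>\<close>; what remains is
  again a rescaled kernel, so its integral does not depend on \<open>\<theta>\<close>.\<close>

lemma scaled_kernel_moment:
  fixes K :: "real^'r \<Rightarrow> real"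
  assumes \<theta>: "0 < \<theta>"
  shows "norm (y - x) powr \<nu> * scaled_kernel K x \<theta> y =
    \<theta> powr \<nu> * scaled_kernel (\<lambda>u. norm u powr \<nu> * K u) x \<theta> y"
proof -
  have "norm (y - x) = \<theta> * norm ((y - x) /\<^sub>R \<theta>)"
    using \<theta> by simp
  then have "norm (y - x) powr \<nu> = \<theta> powr \<nu> * norm ((y - x) /\<^sub>R \<theta>) powr \<nu>"
    using \<theta> by (metis norm_ge_zero less_imp_le powr_mult)
  then show ?thesis
    by (simp add: scaled_kernel_def)
qed

text \<open>The comparison is with \<open>g x\<close> times the mass left on \<open>X\<close>, which
  may differ from 1, because the Hoelder bound speaks only about points of \<open>X\<close>. The
  majorant \<open>?m\<close> lives on the whole space and integrates to a multiple of
  \<open>\<theta> powr \<nu>\<close>; \<open>\<bar>H\<bar>\<close> appears since the sign of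
  \<open>H\<close> is open.\<close>

lemma kernel_bias_le:
  fixes K g :: "real^'r \<Rightarrow> real"
  assumes [measurable]: "K \<in> borel_measurable borel" "X \<in> sets borel"
    and g: "(\<lambda>y. indicator X y * g y) \<in> borel_measurable borel"
    and K: "\<And>u. 0 \<le> K u" "integrable lborel K" "integrable lborel (\<lambda>u. norm u powr \<nu> * K u)"
    and hoelder: "\<And>y. y \<in> X \<Longrightarrow> \<bar>g x - g y\<bar> \<le> H * norm (x - y) powr \<nu>"
    and \<theta>: "0 < \<theta>"
  shows "\<bar>(LBINT y. indicator X y * g y * scaled_kernel K x \<theta> y) -
      g x * (LBINT y:X. scaled_kernel K x \<theta> y)\<bar>
    \<le> \<bar>H\<bar> * (\<theta> powr \<nu> * (LBINT u. norm u powr \<nu> * K u))"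
proof -
  let ?s = "scaled_kernel K x \<theta>"
  let ?m = "\<lambda>y. \<bar>H\<bar> * (\<theta> powr \<nu> * scaled_kernel (\<lambda>u. norm u powr \<nu> * K u) x \<theta> y)"
  let ?d = "\<lambda>y. indicator X y * g y * ?s y - g x * (indicator X y * ?s y)"
  note [measurable] = g
  have s: "integrable lborel (\<lambda>y. g x * (indicator X y * ?s y))"
    using integrable_mult_indicator[OF _ integrable_scaled_kernel[OF _ K(2) \<theta>], of X x] by simp
  have m: "integrable lborel ?m"
    using integrable_scaled_kernel[OF _ K(3) \<theta>, of x] by simp
  have d_le: "\<bar>?d y\<bar> \<le> ?m y" for y
  proof (cases "y \<in> X")
    case True
    have "\<bar>?d y\<bar> = \<bar>g x - g y\<bar> * ?s y"
      using True scaled_kernel_nonneg[where K = K and x = x and y = y, OF K(1) \<theta>]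
      by (simp add: abs_mult abs_minus_commute flip: left_diff_distrib)
    also have "\<dots> \<le> \<bar>H\<bar> * norm (y - x) powr \<nu> * ?s y"
    proof (rule mult_right_mono)
      have "\<bar>g x - g y\<bar> \<le> H * norm (x - y) powr \<nu>"
        by (rule hoelder[OF True])
      also have "\<dots> \<le> \<bar>H\<bar> * norm (x - y) powr \<nu>"
        by (intro mult_right_mono) auto
      finally show "\<bar>g x - g y\<bar> \<le> \<bar>H\<bar> * norm (y - x) powr \<nu>"
        by (simp add: norm_minus_commute)
    qed (rule scaled_kernel_nonneg[OF K(1) \<theta>])
    also have "\<dots> = ?m y"
      by (simp only: mult.assoc scaled_kernel_moment[OF \<theta>])
    finally show ?thesis .
  next
    case False
    then show ?thesis
      using scaled_kernel_nonneg[of "\<lambda>u. norm u powr \<nu> * K u" \<theta> x y] K(1) \<theta> by simp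
  qed
  have d: "integrable lborel ?d"
  proof (rule Bochner_Integration.integrable_bound[OF m])
    show "AE y in lborel. norm (?d y) \<le> norm (?m y)"
      unfolding real_norm_def by (intro AE_I2 order_trans[OF d_le abs_ge_self])
  qed measurable
  have "integrable lborel (\<lambda>y. ?d y + g x * (indicator X y * ?s y))"
    using d s by (rule Bochner_Integration.integrable_add)
  then have gs: "integrable lborel (\<lambda>y. indicator X y * g y * ?s y)"
    by simp
  have "(LBINT y. indicator X y * g y * ?s y) - g x * (LBINT y:X. ?s y) = (LBINT y. ?d y)"
    using gs s by (simp add: set_lebesgue_integral_def)
  also have "\<bar>\<dots>\<bar> \<le> (LBINT y. ?m y)"
    using integral_abs_bound_integral[OF d m] d_le by simp
  also have "\<dots> = \<bar>H\<bar> * (\<theta> powr \<nu> * (LBINT u. norm u powr \<nu> * K u))"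
    using \<theta> by (simp add: integral_scaled_kernel)
  finally show ?thesis .
qed

text \<open>One factor of the square is bounded by \<open>B / \<theta> ^ CARD('r)\<close>; the other
  one integrates to the mass of \<open>K\<close>, uniformly in \<open>\<theta>\<close>.\<close>

lemma kernel_second_moment:
  fixes K \<phi> :: "real^'r \<Rightarrow> real"
  assumes [measurable]: "K \<in> borel_measurable borel" "\<phi> \<in> borel_measurable borel"
    and K: "\<And>u. 0 \<le> K u" "\<And>u. K u \<le> B" "integrable lborel K"
    and \<phi>: "\<And>y. 0 \<le> \<phi> y" "\<And>y. \<phi> y \<le> b" and \<theta>: "0 < \<theta>"
  shows "integrable lborel (\<lambda>y. \<phi> y * (scaled_kernel K x \<theta> y)\<^sup>2)"
    and "(LBINT y. \<phi> y * (scaled_kernel K x \<theta> y)\<^sup>2) \<le> b * B * (LBINT u. K u) / \<theta> ^ CARD('r)"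
proof -
  let ?s = "scaled_kernel K x \<theta>"
  have B: "0 \<le> B" and b: "0 \<le> b"
    using K(1,2) \<phi> by (blast intro: order_trans)+
  have s_le: "?s y \<le> B / \<theta> ^ CARD('r)" for y
    using K(2) \<theta> by (simp add: scaled_kernel_def divide_right_mono)
  have s: "integrable lborel ?s"
    by (rule integrable_scaled_kernel[OF _ K(3) \<theta>]) simp
  have le: "\<phi> y * (?s y)\<^sup>2 \<le> b * (B / \<theta> ^ CARD('r)) * ?s y" for y
  proof -
    have "(?s y)\<^sup>2 \<le> B / \<theta> ^ CARD('r) * ?s y"
      using s_le[of y] scaled_kernel_nonneg[where K = K and x = x and y = y, OF K(1) \<theta>]
      unfolding power2_eq_square by (rule mult_right_mono)
    then have "\<phi> y * (?s y)\<^sup>2 \<le> b * (B / \<theta> ^ CARD('r) * ?s y)"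
      using \<phi> b by (intro mult_mono) auto
    then show ?thesis
      by (simp add: mult.assoc)
  qed
  show int: "integrable lborel (\<lambda>y. \<phi> y * (?s y)\<^sup>2)"
  proof (rule Bochner_Integration.integrable_bound)
    show "integrable lborel (\<lambda>y. b * (B / \<theta> ^ CARD('r)) * ?s y)"
      using s by simp
    have "norm (\<phi> y * (?s y)\<^sup>2) \<le> norm (b * (B / \<theta> ^ CARD('r)) * ?s y)" for y
      using order_trans[OF le abs_ge_self] \<phi>(1)[of y] by (simp only: real_norm_def abs_mult) simp
    then show "AE y in lborel. norm (\<phi> y * (?s y)\<^sup>2) \<le> norm (b * (B / \<theta> ^ CARD('r)) * ?s y)"
      by simp
  qed measurable
  have "(LBINT y. \<phi> y * (?s y)\<^sup>2) \<le> (LBINT y. b * (B / \<theta> ^ CARD('r)) * ?s y)"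
    using int s le by (intro integral_mono) auto
  also have "\<dots> = b * B * (LBINT u. K u) / \<theta> ^ CARD('r)"
    using integral_scaled_kernel[OF assms(1) \<theta>, of x] by simp
  finally show "(LBINT y. \<phi> y * (?s y)\<^sup>2) \<le> b * B * (LBINT u. K u) / \<theta> ^ CARD('r)" .
qed

text \<open>On the unit ball \<open>K\<close> is bounded by \<open>B\<close>; outside it
  \<open>norm u powr \<nu> \<ge> 1\<close>, so the moment dominates. This supplies integrability on
  the whole space when the normalisation concerns \<open>X\<close> alone.\<close>

lemma integrable_if_moment:
  fixes K :: "'a::euclidean_space \<Rightarrow> real"
  assumes [measurable]: "K \<in> borel_measurable borel"
    and K: "\<And>u. 0 \<le> K u" "\<And>u. K u \<le> B" and \<nu>: "0 < \<nu>"
    and int: "integrable lborel (\<lambda>u. norm u powr \<nu> * K u)"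
  shows "integrable lborel K"
proof (rule Bochner_Integration.integrable_bound)
  have "integrable lborel (\<lambda>u::'a. indicator (cball 0 1) u * B)"
    using emeasure_bounded_finite[of "cball 0 1 :: 'a set"]
    by (intro integrable_mult_left integrable_real_indicator) auto
  then show "integrable lborel (\<lambda>u. indicator (cball 0 1) u * B + norm u powr \<nu> * K u)"
    using int by simp
  show "AE u in lborel. norm (K u) \<le> norm (indicator (cball 0 1) u * B + norm u powr \<nu> * K u)"
  proof (rule AE_I2)
    fix u :: 'a
    have "K u \<le> indicator (cball 0 1) u * B + norm u powr \<nu> * K u"
    proof (cases "norm u \<le> 1")
      case True
      then show ?thesis
        using K[of u] by (simp add: add_increasing2)
    next
      case False
      then have "1 * K u \<le> norm u powr \<nu> * K u"
        using K(1)[of u] \<nu> by (intro mult_right_mono ge_one_powr_ge_zero) auto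
      then show ?thesis
        using False by simp
    qed
    then show "norm (K u) \<le> norm (indicator (cball 0 1) u * B + norm u powr \<nu> * K u)"
      using K(1)[of u] by simp
  qed
qed simp

section \<open>Tracking\<close>

theorem theorem3:
  fixes X :: "(real^'r) set"
    and glow gup :: "real^'r \<Rightarrow> real" and gbar :: real
    and g :: "nat \<Rightarrow> real^'r \<Rightarrow> real"
    and M :: "'w measure" and xbar :: "nat \<Rightarrow> 'w \<Rightarrow> real^'r"
    and K :: "real^'r \<Rightarrow> real" and Kbar :: real
    and x :: "real^'r" and \<delta> :: "nat \<Rightarrow> real^'r \<Rightarrow> real" and H \<nu> :: real
    and \<rho> \<theta> :: "nat \<Rightarrow> 'w \<Rightarrow> real" and z0 :: real
  assumes X: "X \<in> sets borel" and x: "x \<in> X"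
    and M: "prob_space M"
    and indep: "prob_space.indep_vars M (\<lambda>_. borel) xbar UNIV"
    and dens: "\<And>t. distributed M lborel (xbar t) (\<lambda>y. ennreal (indicator X y * g t y))"
    and G: "\<And>t. g t \<in> density_class X glow gup gbar"
    and drift: "\<And>t. \<bar>g (Suc t) x - g t x\<bar> \<le> \<delta> t x"
    and drift_lim: "(\<lambda>t. \<delta> t x) \<longlonglongrightarrow> 0"
    and K_borel: "K \<in> borel_measurable borel"
    and K_nonneg: "\<And>y. 0 \<le> K y"
    and K_bounded: "bounded (range K)"
    and K_mass: "(LBINT y:X. K y) = 1"
    and K_sup: "\<And>y. y \<in> X \<Longrightarrow> K y \<le> Kbar"
    and K_moment: "(\<integral>\<^sup>+y. ennreal (norm y powr \<nu> * K y) \<partial>lborel) < \<infinity>"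
    and K_local: "keeps_mass_at X K x"
    and \<rho>_adapted: "\<And>t. \<rho> t \<in> borel_measurable (past M xbar t)"
    and \<theta>_adapted: "\<And>t. \<theta> t \<in> borel_measurable (past M xbar t)"
    and \<rho>_pos: "\<And>t \<omega>. \<omega> \<in> space M \<Longrightarrow> \<rho> t \<omega> > 0"
    and \<theta>_pos: "\<And>t \<omega>. \<omega> \<in> space M \<Longrightarrow> \<theta> t \<omega> > 0"
    and drift_rate: "AE \<omega> in M. (\<lambda>t. \<delta> t x / \<rho> t \<omega>) \<longlonglongrightarrow> 0"
    and \<rho>_lim: "AE \<omega> in M. (\<lambda>t. \<rho> t \<omega>) \<longlonglongrightarrow> 0"
    and \<theta>_lim: "AE \<omega> in M. (\<lambda>t. \<theta> t \<omega>) \<longlonglongrightarrow> 0"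
    and \<rho>_sum: "AE \<omega> in M. (\<Sum>t. ennreal (\<rho> t \<omega>)) = \<infinity>"
    and \<rho>_sq_sum:
      "(\<Sum>t. \<integral>\<^sup>+\<omega>. ennreal ((\<rho> t \<omega>)\<^sup>2 / (\<theta> t \<omega>) ^ CARD('r)) \<partial>M) < \<infinity>"
    and z0: "z0 \<in> {glow x..gup x}"
    and hoelder: "globally_hoelder_at X g x H \<nu>"
  shows "AE \<omega> in M.
    (\<lambda>t. sqg_estimate K glow gup x z0 (\<lambda>s. \<rho> s \<omega>) (\<lambda>s. \<theta> s \<omega>) (\<lambda>s. xbar s \<omega>) t
          - g t x) \<longlonglongrightarrow> 0"
proof -
  interpret prob_space M by (rule M)
  let ?F = "past M xbar"
  let ?N = "\<lambda>t. distr M borel (xbar t)"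
  let ?z = "\<lambda>t \<omega>. sqg_estimate K glow gup x z0 (\<lambda>s. \<rho> s \<omega>) (\<lambda>s. \<theta> s \<omega>) (\<lambda>s. xbar s \<omega>) t"
  define \<phi> where "\<phi> t y = indicator X y * g t y" for t y
  define s where "s t p = scaled_kernel K x (\<theta> t (fst p)) (snd p)" for t and p :: "'w \<times> (real^'r)"
  define mean where "mean t \<omega> = (\<integral>y. s t (\<omega>, y) \<partial>?N t)" for t \<omega>
  define e where "e t \<omega> = s t (\<omega>, xbar t \<omega>) - mean t \<omega>" for t \<omega>
  define J where "J = (LBINT u. norm u powr \<nu> * K u)"
  note [measurable] = K_borel X

  \<comment> \<open>Bounds on the densities, laws of the observations, kernel constants\<close>
  have xbar: "\<And>t. xbar t \<in> borel_measurable M"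
    using indep by (simp add: indep_vars_def)
  note subalg = subalgebra_past[of xbar M, OF xbar]
  have \<nu>: "0 < \<nu>" and H: "\<And>t y. y \<in> X \<Longrightarrow> \<bar>g t x - g t y\<bar> \<le> H * norm (x - y) powr \<nu>"
    using hoelder by (auto simp: globally_hoelder_at_def)
  have gx: "g t x \<in> {glow x..gup x}" "0 \<le> g t x" "g t x \<le> gbar" for t
    using G[of t] x by (force simp: density_class_def)+
  have gx_bounds: "0 \<le> glow x" "gup x \<le> gbar"
    using G[of 0] x by (auto simp: density_class_def)
  have gbar: "0 \<le> gbar"
    using gx[of 0] by linarith
  have z_in: "?z t \<omega> \<in> {glow x..gup x}" for t \<omega>
    using z0 gx(1)[of 0] by (cases t) (auto simp: Let_def)
  have \<phi>: "0 \<le> \<phi> t y" "\<phi> t y \<le> gbar" for t y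
    using G[of t] gbar by (force simp: \<phi>_def density_class_def indicator_def)+
  have \<phi>_meas[measurable]: "\<phi> t \<in> borel_measurable borel" for t
  proof -
    have "distributed M lborel (xbar t) (\<lambda>y. ennreal (\<phi> t y))"
      using dens[of t] by (simp add: \<phi>_def)
    then show ?thesis
      using distributed_real_measurable[of lborel "\<phi> t" M "xbar t"] \<phi>(1) by simp
  qed
  have N: "?N t = density lborel (\<lambda>y. ennreal (\<phi> t y))" for t
    using distributed_distr_eq_density[OF dens[of t]] by (simp add: \<phi>_def cong: distr_cong)
  have N_int: "(\<integral>y. f y \<partial>?N t) = (LBINT y. \<phi> t y * f y)"
    and N_integrable: "integrable (?N t) f \<longleftrightarrow> integrable lborel (\<lambda>y. \<phi> t y * f y)"
    if "f \<in> borel_measurable borel" for t and f :: "real^'r \<Rightarrow> real"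
    using that \<phi>(1) by (simp_all add: N integral_density integrable_density)

  \<comment> \<open>A bound on the whole space: the rescaled argument of the kernel may leave
    \<open>X\<close> even when the observation lies in \<open>X\<close>.\<close>
  obtain B where B: "\<And>u. K u \<le> B"
    using K_bounded unfolding bounded_iff by (auto intro: order_trans[OF abs_ge_self])
  have K_mom: "integrable lborel (\<lambda>u. norm u powr \<nu> * K u)"
    using K_moment K_nonneg by (intro integrableI_nonneg) auto
  have K_int: "integrable lborel K"
    by (rule integrable_if_moment[OF _ K_nonneg B \<nu> K_mom]) simp
  define C where "C = gbar * B * (LBINT u. K u)"
  have C: "0 \<le> C"
    using gbar order_trans[OF K_nonneg B] K_nonneg by (auto simp: C_def intro!: mult_nonneg_nonneg)

  \<comment> \<open>Measurability with respect to the past\<close>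
  have \<theta>_meas: "\<theta> t \<in> borel_measurable (?F t)" and \<rho>_meas: "\<rho> t \<in> borel_measurable (?F t)" for t
    using \<theta>_adapted \<rho>_adapted by auto
  have s_meas: "s t \<in> borel_measurable (?F t \<Otimes>\<^sub>M borel)" for t
  proof -
    note [measurable] = \<theta>_meas[of t]
    show ?thesis
      unfolding s_def by measurable
  qed
  have s_sq: "integrable (?N t) (\<lambda>y. (s t (\<omega>, y))\<^sup>2)"
    and s_sq_le: "(\<integral>y. (s t (\<omega>, y))\<^sup>2 \<partial>?N t) \<le> C / \<theta> t \<omega> ^ CARD('r)"
    if "\<omega> \<in> space M" for t \<omega>
    using kernel_second_moment[OF _ \<phi>_meas K_nonneg B K_int \<phi> \<theta>_pos[OF that], of t x t]
    by (simp_all add: s_def C_def N_int N_integrable)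
  have s_int: "integrable (?N t) (\<lambda>y. s t (\<omega>, y))" if "\<omega> \<in> space M" for t \<omega>
  proof -
    interpret N: prob_space "?N t"
      using xbar by (rule prob_space_distr)
    show ?thesis
      by (rule N.square_integrable_imp_integrable[OF _ s_sq[OF that]]) (simp add: s_def)
  qed
  note ctx = subalg xbar indep_set_past[OF indep]
  have mean_meas: "mean t \<in> borel_measurable (?F t)" for t
    using borel_measurable_integral_section[OF ctx s_meas] by (simp add: mean_def[abs_def])
  have F_Suc: "f \<in> borel_measurable (?F t) \<Longrightarrow> f \<in> borel_measurable (?F (Suc t))"
    for f :: "'w \<Rightarrow> real" and t
    by (rule measurable_from_subalg[OF past_mono[OF le_SucI[OF order_refl]]])
  have s_xbar: "(\<lambda>\<omega>. s t (\<omega>, xbar t \<omega>)) \<in> borel_measurable (?F (Suc t))" for t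
    unfolding s_def
    using F_Suc[OF \<theta>_meas[of t]] measurable_past[of t "Suc t" xbar M] by simp
  have e_meas: "e t \<in> borel_measurable (?F (Suc t))" for t
    unfolding e_def using s_xbar[of t] F_Suc[OF mean_meas[of t]] by simp
  \<comment> \<open>The estimate at time \<open>t\<close> uses observations before \<open>t\<close>
    only, so it may serve in a weight for the noise at time \<open>t\<close>.\<close>
  have z_meas: "?z t \<in> borel_measurable (?F t)" for t
  proof (induction t)
    case (Suc t)
    note [measurable] = F_Suc[OF Suc] F_Suc[OF \<rho>_meas[of t]] s_xbar[of t]
    have "?z (Suc t) = (\<lambda>\<omega>. min (gup x) (max (glow x)
        (?z t \<omega> - \<rho> t \<omega> * (?z t \<omega> - s t (\<omega>, xbar t \<omega>)))))"
      by (simp add: s_def Let_def)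
    also have "\<dots> \<in> borel_measurable (?F (Suc t))"
      by measurable
    finally show ?case .
  qed simp

  \<comment> \<open>Second moments of the weighted noise\<close>
  have second_moment: "(\<integral>\<^sup>+\<omega>. ennreal ((c \<omega> * e t \<omega>)\<^sup>2) \<partial>M)
      \<le> ennreal (D * C) * (\<integral>\<^sup>+\<omega>. ennreal ((\<rho> t \<omega>)\<^sup>2 / \<theta> t \<omega> ^ CARD('r)) \<partial>M)"
    if c: "c \<in> borel_measurable (?F t)" and c_le: "\<And>\<omega>. \<omega> \<in> space M \<Longrightarrow> (c \<omega>)\<^sup>2 \<le> D * (\<rho> t \<omega>)\<^sup>2"
    for c t D
  proof -
    have [measurable]: "\<rho> t \<in> borel_measurable M" "\<theta> t \<in> borel_measurable M"
      using measurable_from_subalg[OF subalg] \<rho>_meas \<theta>_meas by blast+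
    have "(\<integral>\<^sup>+\<omega>. ennreal ((c \<omega> * e t \<omega>)\<^sup>2) \<partial>M) \<le>
        (\<integral>\<^sup>+\<omega>. ennreal ((c \<omega>)\<^sup>2 * (C / \<theta> t \<omega> ^ CARD('r))) \<partial>M)"
      unfolding e_def mean_def
      by (rule centered_second_moment_le[OF ctx s_meas c s_sq s_sq_le])
    also have "\<dots> \<le> (\<integral>\<^sup>+\<omega>. ennreal (D * C) * ennreal ((\<rho> t \<omega>)\<^sup>2 / \<theta> t \<omega> ^ CARD('r)) \<partial>M)"
    proof (rule nn_integral_mono)
      fix \<omega> assume \<omega>: "\<omega> \<in> space M"
      have "(c \<omega>)\<^sup>2 * (C / \<theta> t \<omega> ^ CARD('r)) \<le> D * (\<rho> t \<omega>)\<^sup>2 * (C / \<theta> t \<omega> ^ CARD('r))"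
        using c_le[OF \<omega>] C \<theta>_pos[OF \<omega>, of t] by (intro mult_right_mono) auto
      then have "ennreal ((c \<omega>)\<^sup>2 * (C / \<theta> t \<omega> ^ CARD('r))) \<le>
          ennreal (D * C * ((\<rho> t \<omega>)\<^sup>2 / \<theta> t \<omega> ^ CARD('r)))"
        by (intro ennreal_leI) (simp add: ac_simps)
      also have "\<dots> = ennreal (D * C) * ennreal ((\<rho> t \<omega>)\<^sup>2 / \<theta> t \<omega> ^ CARD('r))"
        using \<theta>_pos[OF \<omega>, of t] by (intro ennreal_mult'') auto
      finally show "ennreal ((c \<omega>)\<^sup>2 * (C / \<theta> t \<omega> ^ CARD('r))) \<le>
          ennreal (D * C) * ennreal ((\<rho> t \<omega>)\<^sup>2 / \<theta> t \<omega> ^ CARD('r))" .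
    qed
    also have "\<dots> = ennreal (D * C) * (\<integral>\<^sup>+\<omega>. ennreal ((\<rho> t \<omega>)\<^sup>2 / \<theta> t \<omega> ^ CARD('r)) \<partial>M)"
      by (rule nn_integral_cmult) measurable
    finally show ?thesis .
  qed
  \<comment> \<open>Two weights are inserted below: \<open>\<rho>\<close> with \<open>D = 1\<close>
    for the squared noise, and the martingale weight with \<open>D = gbar\<^sup>2\<close>.\<close>
  have fin: "(\<Sum>t. \<integral>\<^sup>+\<omega>. ennreal ((c t \<omega> * e t \<omega>)\<^sup>2) \<partial>M) < \<infinity>"
    if c: "\<And>t. c t \<in> borel_measurable (?F t)"
      and c_le: "\<And>t \<omega>. \<omega> \<in> space M \<Longrightarrow> (c t \<omega>)\<^sup>2 \<le> D * (\<rho> t \<omega>)\<^sup>2" for c D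
  proof -
    have "(\<Sum>t. \<integral>\<^sup>+\<omega>. ennreal ((c t \<omega> * e t \<omega>)\<^sup>2) \<partial>M) \<le>
        (\<Sum>t. ennreal (D * C) * (\<integral>\<^sup>+\<omega>. ennreal ((\<rho> t \<omega>)\<^sup>2 / \<theta> t \<omega> ^ CARD('r)) \<partial>M))"
      by (intro suminf_le second_moment c c_le) auto
    also have "\<dots> < \<infinity>"
      using \<rho>_sq_sum by (simp add: ennreal_mult_less_top)
    finally show ?thesis .
  qed

  \<comment> \<open>Almost sure summability of the two noise series\<close>
  have meas_M: "(\<lambda>\<omega>. (c \<omega> * e t \<omega>)\<^sup>2) \<in> borel_measurable M"
    if "c \<in> borel_measurable (?F t)" for c t
    using measurable_from_subalg[OF subalg that] measurable_from_subalg[OF subalg e_meas[of t]] by simp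
  have noise_sq: "AE \<omega> in M. summable (\<lambda>t. (\<rho> t \<omega> * e t \<omega>)\<^sup>2)"
    using summable_of_nn_integral_suminf(3)[OF meas_M _ fin[of \<rho> 1]] \<rho>_meas by simp

  \<comment> \<open>Convergence of \<open>\<rho>\<close> to 0 need not be uniform over paths, so
    \<open>1 - \<rho> t\<close> can be very negative at a fixed \<open>t\<close>. The truncation at
    0 keeps this factor in \<open>{0..1}\<close>, hence the weight within
    \<open>gbar * \<rho> t\<close> everywhere.\<close>
  define c where "c t \<omega> = \<rho> t \<omega> * max 0 (1 - \<rho> t \<omega>) * (?z t \<omega> - g t x)" for t \<omega>
  have c_meas: "c t \<in> borel_measurable (?F t)" for t
  proof -
    note [measurable] = \<rho>_meas[of t] z_meas[of t]
    show ?thesis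
      unfolding c_def by measurable
  qed
  have c_le: "(c t \<omega>)\<^sup>2 \<le> gbar\<^sup>2 * (\<rho> t \<omega>)\<^sup>2" if "\<omega> \<in> space M" for t \<omega>
  proof -
    have "\<bar>?z t \<omega> - g t x\<bar> \<le> gbar"
      using z_in[of \<omega> t] gx[of t] gx_bounds by auto
    then have "\<bar>c t \<omega>\<bar> \<le> \<rho> t \<omega> * 1 * gbar"
      unfolding c_def abs_mult using \<rho>_pos[OF that, of t] by (intro mult_mono) auto
    then have "(c t \<omega>)\<^sup>2 \<le> (\<rho> t \<omega> * gbar)\<^sup>2"
      by (intro abs_le_square_iff[THEN iffD1]) (auto intro: order_trans)
    then show ?thesis
      by (simp add: power_mult_distrib mult.commute)
  qed
  note c_fin = summable_of_nn_integral_suminf[OF meas_M[OF c_meas] zero_le_power2 fin[OF c_meas c_le]]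
  have mds: "square_integrable_mds M ?F (\<lambda>t \<omega>. c t \<omega> * e t \<omega>)"
  proof unfold_locales
    fix t
    show "subalgebra M (?F t)"
      by (rule subalg)
    show "subalgebra (?F (Suc t)) (?F t)"
      by (rule past_mono) simp
    show "(\<lambda>\<omega>. c t \<omega> * e t \<omega>) \<in> borel_measurable (?F (Suc t))"
      using F_Suc[OF c_meas[of t]] e_meas[of t] by simp
    then have ce: "(\<lambda>\<omega>. c t \<omega> * e t \<omega>) \<in> borel_measurable M"
      by (rule measurable_from_subalg[OF subalg])
    show sq: "integrable M (\<lambda>\<omega>. (c t \<omega> * e t \<omega>)\<^sup>2)"
      by (rule c_fin(1))
    have "integrable M (\<lambda>\<omega>. c t \<omega> * e t \<omega>)"
      by (rule square_integrable_imp_integrable[OF ce sq])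
    then show "AE \<omega> in M. real_cond_exp M (?F t) (\<lambda>\<omega>. c t \<omega> * e t \<omega>) \<omega> = 0"
      unfolding e_def mean_def by (intro centered_cond_exp_0[OF ctx s_meas c_meas] s_int)
  qed
  have noise: "AE \<omega> in M. summable (\<lambda>t. c t \<omega> * e t \<omega>)"
    by (rule square_integrable_mds.AE_summable[OF mds c_fin(2)])

  \<comment> \<open>The bias of the kernel observation\<close>
  have bias: "\<bar>mean t \<omega> - g t x\<bar> \<le> \<bar>H\<bar> * (\<theta> t \<omega> powr \<nu> * J) +
      gbar * \<bar>(LBINT y:X. scaled_kernel K x (\<theta> t \<omega>) y) - 1\<bar>" if "\<omega> \<in> space M" for t \<omega>
  proof -
    \<comment> \<open>Through the intermediate value \<open>g t x * ?I\<close> the bias splits into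
      a Hoelder part and a part due to kernel mass falling outside \<open>X\<close>.\<close>
    let ?I = "LBINT y:X. scaled_kernel K x (\<theta> t \<omega>) y"
    have mean_eq: "mean t \<omega> = (LBINT y. indicator X y * g t y * scaled_kernel K x (\<theta> t \<omega>) y)"
      by (simp add: mean_def s_def N_int \<phi>_def)
    have "\<bar>mean t \<omega> - g t x * ?I\<bar> \<le> \<bar>H\<bar> * (\<theta> t \<omega> powr \<nu> * J)"
      unfolding mean_eq J_def
    proof (rule kernel_bias_le[OF K_borel X _ K_nonneg K_int K_mom H \<theta>_pos[OF that]])
      show "(\<lambda>y. indicator X y * g t y) \<in> borel_measurable borel"
        using \<phi>_meas[of t] by (simp add: \<phi>_def[abs_def])
    qed
    moreover have "\<bar>g t x * (?I - 1)\<bar> \<le> gbar * \<bar>?I - 1\<bar>"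
      using gx[of t] by (simp add: abs_mult mult_right_mono)
    ultimately show ?thesis
      by (simp add: algebra_simps)
  qed

  \<comment> \<open>Convergence on almost every path\<close>
  show ?thesis
    using AE_space drift_rate \<rho>_lim \<theta>_lim \<rho>_sum noise_sq noise
  proof eventually_elim
    case (elim \<omega>)
    show ?case
    proof (rule clamped_tracking_tendsto)
      show "?z 0 \<omega> \<in> {glow x..gup x}"
        by (rule z_in)
      show "g t x \<in> {glow x..gup x}" for t
        by (rule gx)
      show "?z (Suc t) \<omega> = min (gup x) (max (glow x)
          (?z t \<omega> - \<rho> t \<omega> * (?z t \<omega> - (g t x + (mean t \<omega> - g t x) + e t \<omega>))))" for t
        by (simp add: e_def s_def Let_def)
      show "\<bar>g (Suc t) x - g t x\<bar> \<le> \<delta> t x" for t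
        by (rule drift)
      show "(\<lambda>t. \<delta> t x / \<rho> t \<omega>) \<longlonglongrightarrow> 0" "(\<lambda>t. \<rho> t \<omega>) \<longlonglongrightarrow> 0"
        by fact+
      show "0 < \<rho> t \<omega>" for t
        using \<rho>_pos elim(1) .
      show "\<not> summable (\<lambda>t. \<rho> t \<omega>)"
      proof
        assume "summable (\<lambda>t. \<rho> t \<omega>)"
        then have "(\<Sum>t. ennreal (\<rho> t \<omega>)) = ennreal (\<Sum>t. \<rho> t \<omega>)"
          using \<rho>_pos[OF elim(1)] by (intro suminf_ennreal2) (auto intro: less_imp_le)
        then show False
          using elim(5) by simp
      qed
      show "summable (\<lambda>t. \<rho> t \<omega> * max 0 (1 - \<rho> t \<omega>) * (?z t \<omega> - g t x) * e t \<omega>)"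
        using elim(7) by (simp add: c_def)
      show "summable (\<lambda>t. (\<rho> t \<omega> * e t \<omega>)\<^sup>2)"
        by fact
      have \<theta>0: "(\<lambda>t. \<theta> t \<omega>) \<longlonglongrightarrow> 0"
        by fact
      \<comment> \<open>Positivity upgrades convergence to 0 to convergence from the right, as
        \<open>keeps_mass_at\<close> demands.\<close>
      have "filterlim (\<lambda>t. \<theta> t \<omega>) (at_right 0) sequentially"
        using \<theta>0 \<theta>_pos[OF elim(1)] by (auto simp: filterlim_at intro!: always_eventually less_imp_neq[symmetric])
      then have "(\<lambda>t. LBINT y:X. scaled_kernel K x (\<theta> t \<omega>) y) \<longlonglongrightarrow> 1"
        using K_local unfolding keeps_mass_at_def by (rule filterlim_compose[rotated])
      moreover have "(\<lambda>t. \<theta> t \<omega> powr \<nu>) \<longlonglongrightarrow> 0"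
        using \<theta>0 tendsto_const _ \<nu>
        by (rule tendsto_zero_powrI) (use \<theta>_pos[OF elim(1)] in \<open>simp add: less_imp_le\<close>)
      ultimately have "(\<lambda>t. \<bar>H\<bar> * (\<theta> t \<omega> powr \<nu> * J) +
          gbar * \<bar>(LBINT y:X. scaled_kernel K x (\<theta> t \<omega>) y) - 1\<bar>) \<longlonglongrightarrow>
          \<bar>H\<bar> * (0 * J) + gbar * \<bar>1 - 1\<bar>"
        by (intro tendsto_add tendsto_mult tendsto_const tendsto_rabs tendsto_diff)
      then have "(\<lambda>t. \<bar>H\<bar> * (\<theta> t \<omega> powr \<nu> * J) +
          gbar * \<bar>(LBINT y:X. scaled_kernel K x (\<theta> t \<omega>) y) - 1\<bar>) \<longlonglongrightarrow> 0"
        by simp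
      then show "(\<lambda>t. mean t \<omega> - g t x) \<longlonglongrightarrow> 0"
        by (rule Lim_null_comparison[rotated]) (use bias[OF elim(1)] in simp)
    qed
  qed
qed

end
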